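(* Let either $Y=\mathbb{R}$ and $\phi(y)=y^3/3$, or $Y=S^1=\mathbb{R}/2\pi\mathbb{Z}$ and $\phi(y)=\sin y$. For $h\in\,]0,h_0]$ and $\xi\in\mathbb{R}$ let $P_\xi=h\partial_y+\xi+\partial_y\phi$ on $L^2(Y)$, and let $t_1(P_\xi)$ denote its second smallest singular value (counted with multiplicity). (i) When $\xi$ varies in a compact $h$-independent subset of $]-\infty,0[$ when $Y=\mathbb{R}$, and of $]-1,1[$ when $Y=S^1$, there exists a constant $C>0$ such that for $h_0>0$ small enough $t_1(P_\xi)\ge h^{1/2}/C$ uniformly in $\xi$. (ii) For every $C_0>0$, if $C_0h^{2/3}\le-\xi\le1/C_0$ or $-\xi\ge C_0$ when $Y=\mathbb{R}$, and if $C_0h^{2/3}\le1+\xi\le1/C_0$ or $C_0h^{2/3}\le1-\xi\le1/C_0$ when $Y=S^1$, there exists a constant $C>0$ such that for $h_0>0$ small enough $$t_1(P_\xi)\ge h^{1/2}|\xi|^{1/4}/C.$$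
   Context: The domain of $P_\xi$ is $\{u\in L^2(\mathbb{R});\ (1+y^4)^{1/2}u,\ h\partial_yu\in L^2(\mathbb{R})\}$ when $Y=\mathbb{R}$, and $H^1(S^1)$ when $Y=S^1$; $P_\xi^*=-h\partial_y+\xi+\partial_y\phi$ with the same domain. The self-adjoint operator $P_\xi^*P_\xi$ has purely discrete spectrum in $[0,\infty[$; the singular values $0\le t_0(P_\xi)\le t_1(P_\xi)\le\dots$ of $P_\xi$ are the square roots of its eigenvalues, counted with multiplicity.
   Formalization: In (ii) for Y=S^1 the factor |ξ|^{1/4} is replaced by |1-|ξ||^{1/4} (distance of ξ to {-1,1}), since the printed bound fails at ξ=-1+C_0h^{2/3}, where t_1(P_ξ)=O(h^{2/3}). *)

theory Defs
  imports "HOL-Analysis.Analysis"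
begin

datatype base = Line | Circle

text \<open>
  The circle is represented by the fundamental domain from 0 to 2 pi. Elements of L2 are
  functions, to be read modulo equality almost everywhere; on the circle their values outside
  the fundamental domain are irrelevant.
\<close>

fun base_measure :: "base \<Rightarrow> real measure" where
  "base_measure Line = lborel"
| "base_measure Circle = restrict_space lborel {0..<2 * pi}"

fun potential :: "base \<Rightarrow> real \<Rightarrow> real" where
  "potential Line y = y ^ 3 / 3"
| "potential Circle y = sin y"

definition L2 :: "base \<Rightarrow> (real \<Rightarrow> complex) set" where
  "L2 Y = {u \<in> borel_measurable (base_measure Y).
             integrable (base_measure Y) (\<lambda>y. (cmod (u y))\<^sup>2)}"

text \<open>
  Real-valued test functions suffice, by linearity. A smooth function on the circle is a smooth
  2 pi-periodic function on the real line; testing against these (rather than against functions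
  supported inside the fundamental domain) is what makes the weak derivative below the one on
  the closed circle, so that members of the Sobolev space match at the two ends.
\<close>

definition smooth :: "(real \<Rightarrow> real) \<Rightarrow> bool" where
  "smooth f \<longleftrightarrow> (\<forall>k x. (deriv ^^ k) f differentiable at x)"

fun test_function :: "base \<Rightarrow> (real \<Rightarrow> real) \<Rightarrow> bool" where
  "test_function Line f \<longleftrightarrow> smooth f \<and> compact (closure {x. f x \<noteq> 0})"
| "test_function Circle f \<longleftrightarrow> smooth f \<and> (\<forall>x. f (x + 2 * pi) = f x)"

definition has_weak_deriv :: "base \<Rightarrow> (real \<Rightarrow> complex) \<Rightarrow> (real \<Rightarrow> complex) \<Rightarrow> bool" where
  "has_weak_deriv Y u v \<longleftrightarrow> u \<in> L2 Y \<and> v \<in> L2 Y \<and>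
     (\<forall>f. test_function Y f \<longrightarrow>
        (LINT y|base_measure Y. u y * complex_of_real (deriv f y)) =
        - (LINT y|base_measure Y. v y * complex_of_real (f y)))"

text \<open>The choice is unique up to equality almost everywhere.\<close>

definition weak_deriv :: "base \<Rightarrow> (real \<Rightarrow> complex) \<Rightarrow> real \<Rightarrow> complex" where
  "weak_deriv Y u = (SOME v. has_weak_deriv Y u v)"

text \<open>The domain does not depend on h, since h is positive.\<close>

fun P_domain :: "base \<Rightarrow> (real \<Rightarrow> complex) set" where
  "P_domain Line = {u \<in> L2 Line. (\<lambda>y. complex_of_real (sqrt (1 + y ^ 4)) * u y) \<in> L2 Line \<and>
                                (\<exists>v. has_weak_deriv Line u v)}"
| "P_domain Circle = {u \<in> L2 Circle. \<exists>v. has_weak_deriv Circle u v}"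

definition P_op :: "base \<Rightarrow> real \<Rightarrow> real \<Rightarrow> (real \<Rightarrow> complex) \<Rightarrow> real \<Rightarrow> complex" where
  "P_op Y h \<xi> u = (\<lambda>y. complex_of_real h * weak_deriv Y u y
                        + complex_of_real (\<xi> + deriv (potential Y) y) * u y)"

definition P_adj :: "base \<Rightarrow> real \<Rightarrow> real \<Rightarrow> (real \<Rightarrow> complex) \<Rightarrow> real \<Rightarrow> complex" where
  "P_adj Y h \<xi> u = (\<lambda>y. - complex_of_real h * weak_deriv Y u y
                         + complex_of_real (\<xi> + deriv (potential Y) y) * u y)"

definition PP_eigenspace :: "base \<Rightarrow> real \<Rightarrow> real \<Rightarrow> real \<Rightarrow> (real \<Rightarrow> complex) set" where
  "PP_eigenspace Y h \<xi> \<mu> =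
     {u \<in> P_domain Y. P_op Y h \<xi> u \<in> P_domain Y \<and>
        (AE y in base_measure Y. P_adj Y h \<xi> (P_op Y h \<xi> u) y = complex_of_real \<mu> * u y)}"

definition indep_ae :: "base \<Rightarrow> nat \<Rightarrow> (nat \<Rightarrow> real \<Rightarrow> complex) \<Rightarrow> bool" where
  "indep_ae Y n u \<longleftrightarrow>
     (\<forall>c :: nat \<Rightarrow> complex. (AE y in base_measure Y. (\<Sum>j<n. c j * u j y) = 0) \<longrightarrow> (\<forall>j<n. c j = 0))"

text \<open>
  The dimension of the eigenspace as a subspace of L2; it is 0 exactly when the number is not an
  eigenvalue.
\<close>

definition PP_multiplicity :: "base \<Rightarrow> real \<Rightarrow> real \<Rightarrow> real \<Rightarrow> enat" where
  "PP_multiplicity Y h \<xi> \<mu> =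
     Sup {enat n | n. \<exists>u. (\<forall>j<n. u j \<in> PP_eigenspace Y h \<xi> \<mu>) \<and> indep_ae Y n u}"

text \<open>
  The k-th singular value (counting from 0) is the least nonnegative s such that at least k + 1
  eigenvalues, counted with multiplicity, are at most the square of s; the finite set S only
  serves to add up the multiplicities. The values are extended reals solely to have a total
  definition: the spectrum is discrete and unbounded, so every singular value is finite.
\<close>

definition singular_value :: "base \<Rightarrow> real \<Rightarrow> real \<Rightarrow> nat \<Rightarrow> ereal" where
  "singular_value Y h \<xi> k =
     Inf {ereal s | s. 0 \<le> s \<and>
       (\<exists>S. finite S \<and> S \<subseteq> {..s\<^sup>2} \<and> enat (Suc k) \<le> (\<Sum>\<mu>\<in>S. PP_multiplicity Y h \<xi> \<mu>))}"

text \<open>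
  Weight on the circle near the ends of the interval from -1 to 1: the well curvature at a zero of
  xi + cos y degenerates exactly when xi is 1 or -1, so the counterpart of the quarter power of
  |xi| on the line is the quarter power of the distance from xi to those two values, which is
  |1 - |xi||. With |xi| itself the bound would fail on the circle: for xi = -1 + C0 h^(2/3) the
  second singular value is at most a constant times h^(2/3).
\<close>

end

theory Submission
  imports Defs "HOL-Computational_Algebra.Polynomial"
begin

text \<open>
  Put \<open>g = \<xi> + \<phi>'\<close>. For a real multiplier k one has, since \<open>|hu' + gu - ku|\<^sup>2 \<ge> 0\<close>,
  \<open>|hu' + gu|\<^sup>2 \<ge> h (k |u|\<^sup>2)' + (2 k g - k\<^sup>2 - h k') |u|\<^sup>2\<close>.
  If u vanishes at the bottom p of the well (the zero of g with \<open>g' > 0\<close>), k may have the pole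
  \<open>h / (y - p)\<close>. On the line, with \<open>a = sqrt (-\<xi>)\<close>, the choice \<open>k = h / (y - a) + g / 2\<close> gives exactly
  \<open>2 k g - k\<^sup>2 - h k' = h a + 3/4 g\<^sup>2\<close>. On the circle, with \<open>cos \<alpha> = -\<xi>\<close>, the choice
  \<open>k = (h/2) cot ((y + \<alpha>) / 2) + g / 2\<close> gives \<open>(h/2) sin \<alpha> + h\<^sup>2/4 + 3/4 g\<^sup>2\<close>; moving \<open>\<xi>\<close> by d away from
  \<open>-cos \<alpha>\<close> and adding d to k changes this only by a quadratic in d and \<open>cos y - cos \<alpha>\<close>, which
  covers \<open>|\<xi>| > 1\<close>. Integration bounds \<open>P\<^sub>\<xi>\<close> from below on functions vanishing at p, a space of
  codimension one, and hence, by min-max, the second singular value. No smallness of h is needed.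

  Eigenfunctions are only given weakly. By the du Bois-Reymond lemma, u and \<open>v = P\<^sub>\<xi> u\<close> have continuous
  representatives, and the first-order system \<open>h u' = v - g u\<close>, \<open>h v' = g v - \<mu> u\<close> then makes them
  continuously differentiable, so that the classical fundamental theorem of calculus applies.
\<close>

section \<open>Smooth test functions\<close>

text \<open>The factor in \<open>g / 2\<close> is forced. Take \<open>k = r + t g\<close> with r the
  pole term and d = 0. The double poles of \<open>- k^2\<close> and \<open>- h k'\<close> cancel up
  to a constant, and what remains is \<open>2 (1 - t) r g + (2 t - t^2) g^2 - h t g'\<close>. On the
  line \<open>r g = h (y + a)\<close> and \<open>g' = 2 y\<close>, so y enters linearly with
  coefficient \<open>h (2 - 4 t)\<close>, which has no sign on the line unless t = 1/2; on the
  circle the same value of t removes \<open>sin y\<close>. The pole itself cannot be dispensed with: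
  near the bottom of the well a Gaussian is almost annihilated by the operator, and the condition at
  p is what excludes it. Singular values are defined by counting eigenvalues, so min-max is carried
  out by hand.\<close>

lemma smooth_coinduct:
  assumes "X f" and step: "\<And>g. X g \<Longrightarrow> \<exists>g'. X g' \<and> (\<forall>x. (g has_real_derivative g' x) (at x))"
  shows "smooth f"
proof -
  \<comment> \<open>X is an invariant: it contains f and a derivative of each member, hence all
    iterated derivatives, and one further step gives their differentiability.\<close>
  have X: "X ((deriv ^^ k) f)" for k
  proof (induction k)
    case (Suc k)
    then obtain g' where "X g'" "\<forall>x. ((deriv ^^ k) f has_real_derivative g' x) (at x)"
      using step by blast
    moreover from this have "deriv ((deriv ^^ k) f) = g'"
      by (auto intro!: ext DERIV_imp_deriv)
    ultimately show ?case by simp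
  qed (simp add: assms)
  show ?thesis
    unfolding smooth_def
    using step[OF X] real_differentiable_def by blast
qed

lemma smooth_has_deriv:
  assumes "smooth f"
  shows "(f has_real_derivative deriv f x) (at x)"
proof -
  have "(deriv ^^ 0) f differentiable at x"
    using assms unfolding smooth_def by blast
  then show ?thesis
    by (simp add: DERIV_deriv_iff_real_differentiable)
qed

lemma smooth_deriv:
  assumes "smooth f"
  shows "smooth (deriv f)"
  unfolding smooth_def
proof (intro allI)
  fix k x
  have "(deriv ^^ Suc k) f differentiable at x"
    using assms unfolding smooth_def by blast
  then show "(deriv ^^ k) (deriv f) differentiable at x"
    by (simp only: funpow_Suc_right o_apply)
qed

lemma smooth_antideriv:
  assumes "\<And>x. (F has_real_derivative f x) (at x)" "smooth f"
  shows "smooth F"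
\<comment> \<open>The invariant is the smooth class with F as one extra member, whose derivative f
  already lies in the class.\<close>
proof (rule smooth_coinduct[where X = "\<lambda>g. g = F \<or> smooth g"])
  fix g assume "g = F \<or> smooth g"
  then show "\<exists>g'. (g' = F \<or> smooth g') \<and> (\<forall>x. (g has_real_derivative g' x) (at x))"
    using assms smooth_has_deriv smooth_deriv by blast
qed simp

lemma smooth_add:
  assumes "smooth f" "smooth g"
  shows "smooth (\<lambda>x. f x + g x)"
proof (rule smooth_coinduct[where X = "\<lambda>k. \<exists>f g. smooth f \<and> smooth g \<and> k = (\<lambda>x. f x + g x)"])
  fix k :: "real \<Rightarrow> real"
  assume "\<exists>f g. smooth f \<and> smooth g \<and> k = (\<lambda>x. f x + g x)"
  then obtain f g where fg: "smooth f" "smooth g" "k = (\<lambda>x. f x + g x)" by blast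
  have "(k has_real_derivative (deriv f x + deriv g x)) (at x)" for x
    unfolding fg(3) using fg by (intro DERIV_add smooth_has_deriv)
  with fg smooth_deriv
  show "\<exists>g'. (\<exists>f g. smooth f \<and> smooth g \<and> g' = (\<lambda>x. f x + g x)) \<and>
          (\<forall>x. (k has_real_derivative g' x) (at x))"
    by (intro exI[of _ "\<lambda>x. deriv f x + deriv g x"]) blast
qed (use assms in blast)

lemma smooth_affine_comp:
  assumes "smooth f"
  shows "smooth (\<lambda>x. c * f (a * x + b))"
\<comment> \<open>The prefactor c is quantified as well, because the chain rule turns it into
  \<open>c * a\<close> at each differentiation.\<close>
proof (rule smooth_coinduct[where X = "\<lambda>k. \<exists>f c. smooth f \<and> k = (\<lambda>x. c * f (a * x + b))"])
  fix k :: "real \<Rightarrow> real"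
  assume "\<exists>f c. smooth f \<and> k = (\<lambda>x. c * f (a * x + b))"
  then obtain f c where f: "smooth f" "k = (\<lambda>x. c * f (a * x + b))" by blast
  have "(k has_real_derivative (c * a) * deriv f (a * x + b)) (at x)" for x
    unfolding f(2)
    by (rule derivative_eq_intros DERIV_chain2[OF smooth_has_deriv[OF f(1)]] refl | simp)+
  with f smooth_deriv
  show "\<exists>g'. (\<exists>f c. smooth f \<and> g' = (\<lambda>x. c * f (a * x + b))) \<and>
          (\<forall>x. (k has_real_derivative g' x) (at x))"
    by (intro exI[of _ "\<lambda>x. (c * a) * deriv f (a * x + b)"]) blast
qed (use assms in blast)

lemma smooth_const: "smooth (\<lambda>x. c)"
  by (rule smooth_coinduct[where X = "\<lambda>k. \<exists>c. k = (\<lambda>x. c)"])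
     (auto intro!: exI[of _ "\<lambda>x. 0 :: real"])

lemma smooth_diff:
  assumes "smooth f" "smooth g"
  shows "smooth (\<lambda>x. f x - g x)"
  using smooth_add[OF assms(1) smooth_affine_comp[OF assms(2), of "-1" 1 0]] by simp

text \<open>Differentiation is local, so agreement with smooth functions on open sets passes from f
  to \<open>deriv f\<close>. This allows a periodic test function to be glued from
  translates.\<close>

lemma smooth_local:
  assumes "\<And>x. \<exists>S g. open S \<and> x \<in> S \<and> smooth g \<and> (\<forall>y\<in>S. f y = g y)"
  shows "smooth f"
proof (rule smooth_coinduct
    [where X = "\<lambda>f. \<forall>x. \<exists>S g. open S \<and> x \<in> S \<and> smooth g \<and> (\<forall>y\<in>S. f y = g y)"])
  fix f :: "real \<Rightarrow> real"
  assume f: "\<forall>x. \<exists>S g. open S \<and> x \<in> S \<and> smooth g \<and> (\<forall>y\<in>S. f y = g y)"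
  have eq: "(f has_real_derivative deriv g x) (at x)" 
    if "open S" "x \<in> S" "smooth g" "\<forall>y\<in>S. f y = g y" for S g x
    by (rule has_field_derivative_transform_within_open[OF smooth_has_deriv[of g x]])
       (use that in auto)
  have "\<exists>S g. open S \<and> x \<in> S \<and> smooth g \<and> (\<forall>y\<in>S. deriv f y = g y)" for x
  proof -
    obtain S g where "open S" "x \<in> S" "smooth g" "\<forall>y\<in>S. f y = g y"
      using f by blast
    then show ?thesis
      using eq smooth_deriv DERIV_imp_deriv by (intro exI[of _ S] exI[of _ "deriv g"]) blast
  qed
  moreover have "(f has_real_derivative deriv f x) (at x)" for x
    using f eq DERIV_imp_deriv by metis
  ultimately show "\<exists>g'. (\<forall>x. \<exists>S g. open S \<and> x \<in> S \<and> smooth g \<and> (\<forall>y\<in>S. g' y = g y)) \<and>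
          (\<forall>x. (f has_real_derivative g' x) (at x))"
    by blast
qed (use assms in blast)

lemma smooth_continuous: "smooth f \<Longrightarrow> continuous_on S f"
  by (meson DERIV_isCont continuous_at_imp_continuous_on smooth_has_deriv)

text \<open>The derivatives of the bump \<open>exp (-1 / (x (1 - x)))\<close> stay in this family.\<close>

definition bump_poly :: "real poly \<Rightarrow> nat \<Rightarrow> real \<Rightarrow> real" where
  "bump_poly p n x =
     (if 0 < x \<and> x < 1 then poly p x / (x * (1 - x)) ^ n * exp (- 1 / (x * (1 - x))) else 0)"

text \<open>A single term of the exponential series at \<open>1 / q\<close> is at most the sum. The
  bound makes the exponential beat any power in a denominator.\<close>

lemma exp_minus_inverse_le:
  fixes q :: real
  assumes "0 < q"
  shows "exp (- 1 / q) \<le> fact n * q ^ n"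
proof -
  have "(1 / q) ^ n / fact n \<le> exp (1 / q)"
    using assms sum_le_suminf[of "\<lambda>k. (1/q) ^ k /\<^sub>R fact k" "{n}"] summable_exp_generic[of "1 / q"]
    by (simp add: exp_def divide_inverse mult.commute)
  then have "1 / (fact n * q ^ n) \<le> exp (1 / q)"
    by (simp add: power_divide mult.commute)
  then have "1 \<le> exp (1 / q) * (fact n * q ^ n)"
    using assms by (simp add: pos_divide_le_eq)
  then show ?thesis
    by (simp add: exp_minus field_simps)
qed

text \<open>The exponent \<open>n + 2\<close> in the bound for the exponential absorbs the
  denominator \<open>(x * (1 - x)) ^ n\<close> and leaves a square, which is small at both ends of
  the unit interval.\<close>

lemma bump_poly_bound:
  "\<exists>C. \<forall>x. \<bar>bump_poly p n x\<bar> \<le> C * min (x\<^sup>2) ((1 - x)\<^sup>2)"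
proof -
  obtain M where M: "\<And>x. x \<in> {0..1} \<Longrightarrow> \<bar>poly p x\<bar> \<le> M"
    using compact_imp_bounded[OF compact_continuous_image[of "{0..1::real}" "poly p"]]
      continuous_on_poly[OF continuous_on_id, of "{0..1::real}" p]
    unfolding bounded_iff by force
  have M0: "0 \<le> M" using M[of 0] by auto
  have "\<bar>bump_poly p n x\<bar> \<le> (M * fact (n + 2)) * min (x\<^sup>2) ((1 - x)\<^sup>2)" for x
  proof (cases "0 < x \<and> x < 1")
    case True
    define q where "q = x * (1 - x)"
    have q: "0 < q" "q \<le> x" "q \<le> 1 - x"
      using True unfolding q_def by (auto simp: mult_left_le mult_le_cancel_right1)
    have "\<bar>bump_poly p n x\<bar> = \<bar>poly p x\<bar> / q ^ n * exp (- 1 / q)"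
      using True q(1) by (simp add: bump_poly_def q_def[symmetric] abs_mult)
    also have "\<dots> \<le> M / q ^ n * (fact (n + 2) * q ^ (n + 2))"
      using q(1) M[of x] M0 True exp_minus_inverse_le[OF q(1), of "n + 2"]
      by (intro mult_mono divide_right_mono) auto
    also have "\<dots> = M * fact (n + 2) * q\<^sup>2"
      using q(1) by (simp add: power_add power2_eq_square)
    also have "\<dots> \<le> M * fact (n + 2) * min (x\<^sup>2) ((1 - x)\<^sup>2)"
      using q M0 True by (intro mult_left_mono) (auto intro!: power_mono)
    finally show ?thesis .
  qed (use M0 in \<open>auto simp: bump_poly_def intro!: mult_nonneg_nonneg\<close>)
  then show ?thesis by blast
qed

text \<open>Serves the gluing points 0 and 1 of the bump, where the two branches of its definition
  meet.\<close>

lemma quadratic_bound_has_deriv_0: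
  fixes f :: "real \<Rightarrow> real"
  assumes "\<And>x. \<bar>f x\<bar> \<le> C * (x - a)\<^sup>2"
  shows "(f has_real_derivative 0) (at a)"
proof -
  have fa: "f a = 0" using assms[of a] by simp
  have "((\<lambda>x. C * (x - a)) \<longlongrightarrow> C * (a - a)) (at a)" by (intro tendsto_intros)
  then have "((\<lambda>x. \<bar>C * (x - a)\<bar>) \<longlongrightarrow> 0) (at a)" by (simp add: tendsto_rabs_zero)
  moreover have "\<forall>\<^sub>F x in at a. norm ((f x - f a) / (x - a)) \<le> \<bar>C * (x - a)\<bar>"
  proof (rule eventually_at_filter[THEN iffD2], rule always_eventually, intro allI impI)
    fix x assume "x \<noteq> a"
    have "\<bar>f x\<bar> \<le> \<bar>C * (x - a)\<bar> * \<bar>x - a\<bar>"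
      using assms[of x] by (simp add: abs_mult[symmetric] power2_eq_square mult.assoc[symmetric])
    then show "norm ((f x - f a) / (x - a)) \<le> \<bar>C * (x - a)\<bar>"
      using \<open>x \<noteq> a\<close> fa by (simp add: divide_le_eq)
  qed
  ultimately have "((\<lambda>x. (f x - f a) / (x - a)) \<longlongrightarrow> 0) (at a)"
    by (rule Lim_null_comparison[rotated])
  then show ?thesis by (simp add: has_field_derivative_iff)
qed

lemma smooth_bump_poly: "smooth (bump_poly p n)"
proof (rule smooth_coinduct[where X = "\<lambda>f. \<exists>p n. f = bump_poly p n"])
  fix f :: "real \<Rightarrow> real"
  assume "\<exists>p n. f = bump_poly p n"
  then obtain p n where f: "f = bump_poly p n" by blast
  define q :: "real poly" where "q = [:0, 1, -1:]"
  \<comment> \<open>Numerator of the derivative over the common denominator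
    \<open>q ^ (n + 2)\<close>: the three terms come from p, from the power of q and from the
    exponential.\<close>
  define r where "r = pderiv p * q\<^sup>2 - of_nat n * p * pderiv q * q + p * pderiv q"
  have q: "poly q x = x * (1 - x)" for x by (simp add: q_def algebra_simps)
  have "(bump_poly p n has_real_derivative bump_poly r (n + 2) x) (at x)" for x
  proof -
    consider "0 < x \<and> x < 1" | "x = 0" | "x = 1" | "x < 0" | "x > 1" by linarith
    then show ?thesis
    proof cases
      case 1
      then have q0: "poly q x > 0" by (simp add: q)
      have "((\<lambda>x. poly p x / poly q x ^ n * exp (- 1 / poly q x)) has_real_derivative
             poly r x / poly q x ^ (n + 2) * exp (- 1 / poly q x)) (at x)"
      proof -
        have quot: "(P' * Q ^ n - P * (real n * (Q ^ (n - 1) * d))) / (Q ^ n)\<^sup>2 * E + P / Q ^ n * (E * (d / Q\<^sup>2))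
           = (P' * Q\<^sup>2 - real n * P * d * Q + P * d) / Q ^ (n + 2) * E"
          if "Q > 0" for P P' Q d E :: real
          using that by (cases n) (simp_all add: field_simps power2_eq_square)
        have "((\<lambda>x. poly p x / poly q x ^ n * exp (- 1 / poly q x)) has_real_derivative
          (poly (pderiv p) x * poly q x ^ n - poly p x * (real n * (poly q x ^ (n - 1) * poly (pderiv q) x))) / (poly q x ^ n)\<^sup>2
             * exp (- 1 / poly q x)
           + poly p x / poly q x ^ n * (exp (- 1 / poly q x) * (poly (pderiv q) x / (poly q x)\<^sup>2))) (at x)"
          using q0 by (auto intro!: derivative_eq_intros poly_DERIV simp: power2_eq_square field_simps)
        then show ?thesis
          unfolding quot[OF q0] by (simp add: r_def)
      qed
      moreover have "bump_poly r (n + 2) x = poly r x / poly q x ^ (n + 2) * exp (- 1 / poly q x)"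
        using 1 by (simp add: bump_poly_def q)
      ultimately have "((\<lambda>x. poly p x / poly q x ^ n * exp (- 1 / poly q x)) has_real_derivative
          bump_poly r (n + 2) x) (at x)"
        by simp
      then show ?thesis
        by (rule has_field_derivative_transform_within_open[of _ _ _ "{0<..<1}"])
           (use 1 in \<open>auto simp: bump_poly_def q\<close>)
    next
      case 2
      obtain C where C: "\<And>x. \<bar>bump_poly p n x\<bar> \<le> C * min (x\<^sup>2) ((1 - x)\<^sup>2)"
        using bump_poly_bound by blast
      have "\<bar>bump_poly p n x\<bar> \<le> max C 0 * (x - 0)\<^sup>2" for x
      proof -
        have "C * min (x\<^sup>2) ((1 - x)\<^sup>2) \<le> max C 0 * x\<^sup>2"
          by (intro mult_mono) auto
        then show ?thesis using C[of x] by simp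
      qed
      then have "(bump_poly p n has_real_derivative 0) (at 0)"
        by (rule quadratic_bound_has_deriv_0)
      with 2 show ?thesis by (simp add: bump_poly_def)
    next
      case 3
      obtain C where C: "\<And>x. \<bar>bump_poly p n x\<bar> \<le> C * min (x\<^sup>2) ((1 - x)\<^sup>2)"
        using bump_poly_bound by blast
      have "\<bar>bump_poly p n x\<bar> \<le> max C 0 * (x - 1)\<^sup>2" for x
      proof -
        have "C * min (x\<^sup>2) ((1 - x)\<^sup>2) \<le> max C 0 * (x - 1)\<^sup>2"
          by (intro mult_mono) (auto simp: power2_commute)
        then show ?thesis using C[of x] by simp
      qed
      then have "(bump_poly p n has_real_derivative 0) (at 1)"
        by (rule quadratic_bound_has_deriv_0)
      with 3 show ?thesis by (simp add: bump_poly_def)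
    next
      case 4
      show ?thesis
        by (rule has_field_derivative_transform_within_open[of "\<lambda>_. 0" _ _ "{..<0}"])
           (use 4 in \<open>auto simp: bump_poly_def\<close>)
    next
      case 5
      show ?thesis
        by (rule has_field_derivative_transform_within_open[of "\<lambda>_. 0" _ _ "{1<..}"])
           (use 5 in \<open>auto simp: bump_poly_def\<close>)
    qed
  qed
  then show "\<exists>g'. (\<exists>p n. g' = bump_poly p n) \<and> (\<forall>x. (f has_real_derivative g' x) (at x))"
    unfolding f by blast
qed blast

section \<open>A smooth step and its primitive\<close>

lemma antideriv_vanishing_left:
  fixes f :: "real \<Rightarrow> real"
  assumes "continuous_on UNIV f" "\<And>x. x \<le> 0 \<Longrightarrow> f x = 0"
  shows "\<exists>F. (\<forall>x. (F has_real_derivative f x) (at x)) \<and> (\<forall>x\<le>0. F x = 0)"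
proof -
  \<comment> \<open>The lower limit -1 lies strictly left of 0, so every x \<ge> 0 is interior to
    \<open>{-1..x+1}\<close> and the derivative there is two-sided.\<close>
  define F where "F x = integral {-1..x} f" for x
  have F0: "F x = 0" if "x \<le> 0" for x
    unfolding F_def using that assms(2) integral_cong[of "{-1..x}" f "\<lambda>_. 0"] by simp
  have "(F has_real_derivative f x) (at x)" for x
  proof (cases "x < 0")
    case True
    have "(F has_real_derivative 0) (at x)"
      by (rule has_field_derivative_transform_within_open[of "\<lambda>_. 0" _ _ "{..<0}"])
         (use True F0 in auto)
    then show ?thesis using True assms(2) by simp
  next
    case False
    have "((\<lambda>x. integral {-1..x} f) has_real_derivative f x) (at x within {-1..x+1})"
      by (rule integral_has_real_derivative)
         (use False assms(1) in \<open>auto intro: continuous_on_subset\<close>)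
    moreover have "at x within {-1..x+1} = at x"
      using False by (intro at_within_interior) auto
    ultimately show ?thesis unfolding F_def by simp
  qed
  with F0 show ?thesis by blast
qed

text \<open>S is the normalised integral of a bump and T an antiderivative of S. Right of 1 the
  function T is linear up to the offset \<kappa>, which cancels in differences
  \<open>T (m * (y - p)) - T (m * (y - q))\<close>; from these the test functions imitating
  indicators of intervals are built.\<close>

lemma smooth_step_exists:
  "\<exists>T S \<kappa>. smooth T \<and> (\<forall>x. (T has_real_derivative S x) (at x)) \<and> (\<forall>x. 0 \<le> S x \<and> S x \<le> 1)
     \<and> (\<forall>x\<le>0. T x = 0 \<and> S x = 0) \<and> (\<forall>x\<ge>1. T x = x - \<kappa> \<and> S x = 1)"
proof -
  define b where "b = bump_poly 1 0"
  have b: "smooth b" "\<And>x. x \<le> 0 \<Longrightarrow> b x = 0" "\<And>x. x \<ge> 1 \<Longrightarrow> b x = 0" "\<And>x. b x \<ge> 0"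
    "\<And>x. 0 < x \<Longrightarrow> x < 1 \<Longrightarrow> b x > 0"
    by (simp_all add: b_def smooth_bump_poly) (simp_all add: bump_poly_def)
  obtain F where F: "\<And>x. (F has_real_derivative b x) (at x)" "\<And>x. x \<le> 0 \<Longrightarrow> F x = 0"
    using antideriv_vanishing_left[of b] smooth_continuous[OF b(1)] b(2) by blast
  have F_mono: "F x \<le> F y" if "x \<le> y" for x y
    by (rule DERIV_nonneg_imp_nondecreasing[OF that]) (use F b(4) in blast)
  have F_cont: "continuous_on A F" for A
    by (meson F(1) DERIV_isCont continuous_at_imp_continuous_on)
  have F1: "F x = F 1" if "x \<ge> 1" for x
  proof (cases "x = 1")
    case False
    have "F x = F 1"
    proof (rule DERIV_isconst_end[of 1 x])
      show "(F has_real_derivative 0) (at y)" if "1 < y" for y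
        using F(1)[of y] b(3)[of y] that by simp
    qed (use that False F_cont in auto)
    then show ?thesis .
  qed simp
  \<comment> \<open>The bump is positive on the middle third, which makes the normalising constant
    \<open>F 1\<close> positive.\<close>
  have "F (1/3) < F (2/3)"
  proof (rule DERIV_pos_imp_increasing[of "1/3" "2/3" F])
    show "\<exists>y. (F has_real_derivative y) (at x) \<and> 0 < y" if "1/3 \<le> x" "x \<le> 2/3" for x
      using F(1)[of x] b(5)[of x] that by (intro exI[of _ "b x"]) simp
  qed simp
  then have F1pos: "F 1 > 0"
    using F_mono[of "2/3" 1] F_mono[of 0 "1/3"] F(2)[of 0] by linarith
  define S where "S x = F x / F 1" for x
  have S_deriv: "(S has_real_derivative b x / F 1) (at x)" for x
    unfolding S_def using F(1) by (intro DERIV_cdivide)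
  have S: "0 \<le> S x" "S x \<le> 1" "x \<le> 0 \<Longrightarrow> S x = 0" "x \<ge> 1 \<Longrightarrow> S x = 1" for x
  proof -
    show "0 \<le> S x" using F_mono[of "min x 0" x] F(2)[of "min x 0"] F1pos by (simp add: S_def)
    have "F x \<le> F 1" using F_mono[of x "max x 1"] F1[of "max x 1"] by linarith
    then show "S x \<le> 1" using F1pos by (simp add: S_def)
    show "S x = 0" if "x \<le> 0" using F(2)[OF that] by (simp add: S_def)
    show "S x = 1" if "x \<ge> 1" unfolding S_def F1[OF that] using F1pos by simp
  qed
  have "smooth S"
    using smooth_antideriv[OF S_deriv] smooth_affine_comp[OF b(1), of "1 / F 1" 1 0] by simp
  obtain T where T: "\<And>x. (T has_real_derivative S x) (at x)" "\<And>x. x \<le> 0 \<Longrightarrow> T x = 0"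
    using antideriv_vanishing_left[of S] smooth_continuous[OF \<open>smooth S\<close>] S(3) by blast
  have "smooth T" using smooth_antideriv[OF T(1) \<open>smooth S\<close>] .
  have T_deriv: "((\<lambda>x. T x - x) has_real_derivative (S x - 1)) (at x)" for x
    by (intro DERIV_diff T DERIV_ident)
  have "T x = x - (1 - T 1)" if "x \<ge> 1" for x
  proof (cases "x = 1")
    case False
    have "T x - x = T 1 - 1"
    proof (rule DERIV_isconst_end[of 1 x "\<lambda>x. T x - x"])
      show "continuous_on {1..x} (\<lambda>x. T x - x)"
        using T_deriv DERIV_isCont by (intro continuous_at_imp_continuous_on) blast
      show "((\<lambda>x. T x - x) has_real_derivative 0) (at y)" if "1 < y" for y
        using T_deriv[of y] S(4)[of y] that by simp
    qed (use that False in auto)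
    then show ?thesis by simp
  qed simp
  with S T \<open>smooth T\<close> show ?thesis
    by (intro exI[of _ T] exI[of _ S] exI[of _ "1 - T 1"]) blast
qed

section \<open>The du Bois-Reymond lemma\<close>

text \<open>Rays form an intersection-stable generator of the Borel sets. The sets over which f
  integrates to zero are closed under complements, because the total integral vanishes, and under
  countable disjoint unions; so all Borel sets are among them.\<close>

lemma AE_zero_if_ray_integrals_zero:
  fixes f :: "real \<Rightarrow> 'a :: {banach, second_countable_topology}"
  assumes f: "integrable lborel f" and "(LINT x|lborel. f x) = 0"
    and rays: "\<And>a. (LINT x:{a<..}|lborel. f x) = 0"
  shows "AE x in lborel. f x = 0"
proof (rule sigma_finite_measure.density_unique_banach[OF sigma_finite_lborel])
  fix A :: "real set" assume "A \<in> sets lborel"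
  then have mem: "A \<in> sigma_sets UNIV (range greaterThan)"
    by (simp add: borel_Ioi)
  have stable: "Int_stable (range greaterThan :: real set set)"
  proof (rule Int_stableI_image)
    show "\<exists>c\<in>UNIV. {a<..} \<inter> {b<..} = {c<..}" for a b :: real
      by (intro bexI[of _ "max a b"]) auto
  qed
  have si: "set_integrable lborel B f" if "B \<in> sets borel" for B
    using f that by (simp add: set_integrable_def integrable_mult_indicator)
  have eq: "sigma_sets UNIV (range greaterThan) = (sets borel :: real set set)"
    by (simp add: borel_Ioi)
  have "range greaterThan \<subseteq> Pow (UNIV :: real set)" by simp
  from stable this mem have "(LINT x:A|lborel. f x) = 0"
  proof (induction rule: sigma_sets_induct_disjoint)
    case (compl A)
    then have A: "A \<in> sets borel" by (simp add: eq)
    have "(LINT x:A \<union> (UNIV - A)|lborel. f x) = (LINT x:A|lborel. f x) + (LINT x:UNIV - A|lborel. f x)"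
      using A by (intro set_integral_Un si) auto
    then show ?case using assms compl by (simp add: set_lebesgue_integral_def)
  next
    case (union A)
    have "(LINT x:(\<Union>i. A i)|lborel. f x) = (\<Sum>i. (LINT x:A i|lborel. f x))"
      using union by (intro lebesgue_integral_countable_add si)
        (auto simp: eq disjoint_family_on_def)
    then show ?case using union by simp
  qed (use rays in \<open>auto simp: set_lebesgue_integral_def[of _ "{}"]\<close>)
  then show "(LINT x:A|lborel. f x) = (LINT x:A|lborel. 0)" by simp
qed (use f in auto)

lemma set_integrable_bounded_mult:
  fixes w :: "real \<Rightarrow> complex" and g :: "real \<Rightarrow> real"
  assumes w: "set_integrable lborel A w" and [measurable]: "g \<in> borel_measurable borel"
    and "\<And>x. \<bar>g x\<bar> \<le> B"
  shows "set_integrable lborel A (\<lambda>x. g x *\<^sub>R w x)"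
  unfolding set_integrable_def
proof (rule Bochner_Integration.integrable_bound)
  have [measurable]: "(\<lambda>x. indicator A x *\<^sub>R w x) \<in> borel_measurable lborel"
    using w unfolding set_integrable_def by (rule borel_measurable_integrable)
  have "(\<lambda>x. g x *\<^sub>R (indicator A x *\<^sub>R w x)) \<in> borel_measurable lborel"
    by measurable
  then show "(\<lambda>x. indicat_real A x *\<^sub>R g x *\<^sub>R w x) \<in> borel_measurable lborel"
    by (simp add: mult.commute)
  show "integrable lborel (\<lambda>x. B *\<^sub>R (indicator A x *\<^sub>R w x))"
    using w unfolding set_integrable_def by (rule integrable_scaleR_right)
  show "AE x in lborel. norm (indicat_real A x *\<^sub>R g x *\<^sub>R w x) \<le> norm (B *\<^sub>R (indicat_real A x *\<^sub>R w x))"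
  proof (intro AE_I2)
    fix x
    have "\<bar>g x\<bar> * norm (w x) \<le> \<bar>B\<bar> * norm (w x)"
      using assms(3)[of x] by (intro mult_right_mono) auto
    then show "norm (indicat_real A x *\<^sub>R g x *\<^sub>R w x) \<le> norm (B *\<^sub>R (indicat_real A x *\<^sub>R w x))"
      by (simp add: indicator_def)
  qed
qed

text \<open>The derivatives of the test functions \<open>f n\<close> are smoothed differences of two
  normalised indicators. Each indicator has integral one, so \<open>f n\<close> returns to zero to
  the right of both intervals and is admissible; dominated convergence then passes to the sharp
  indicators.\<close>

lemma averages_eq_if_weakly_constant:
  fixes w :: "real \<Rightarrow> complex"
  assumes I: "open I" and w: "\<And>p q. p \<in> I \<Longrightarrow> q \<in> I \<Longrightarrow> set_integrable lborel {p..q} w"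
    and weak: "\<And>f p q. smooth f \<Longrightarrow> p \<in> I \<Longrightarrow> q \<in> I \<Longrightarrow> (\<And>x. x \<notin> {p..q} \<Longrightarrow> f x = 0) \<Longrightarrow>
        (LINT y:{p..q}|lborel. deriv f y *\<^sub>R w y) = 0"
    and pq: "p \<in> I" "q \<in> I" "p < q" and rs: "r \<in> I" "s \<in> I" "r < s"
  shows "(LINT y:{p<..q}|lborel. w y) /\<^sub>R (q - p) = (LINT y:{r<..s}|lborel. w y) /\<^sub>R (s - r)"
proof -
  obtain T S \<kappa> where T: "smooth T" "\<And>x. (T has_real_derivative S x) (at x)"
    "\<And>x. x \<le> 0 \<Longrightarrow> T x = 0" "\<And>x. x \<ge> 1 \<Longrightarrow> T x = x - \<kappa>"
    and S: "\<And>x. 0 \<le> S x" "\<And>x. S x \<le> 1" "\<And>x. x \<le> 0 \<Longrightarrow> S x = 0" "\<And>x. x \<ge> 1 \<Longrightarrow> S x = 1"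
    using smooth_step_exists by blast
  define A where "A = min p r"
  define B0 where "B0 = max q s"
  have AB: "A \<in> I" "B0 \<in> I" using pq rs by (auto simp: A_def B0_def min_def max_def)
  obtain e where e: "e > 0" "\<And>x. dist x B0 < e \<Longrightarrow> x \<in> I"
    using I AB(2) unfolding open_dist by blast
  \<comment> \<open>The ramps have width \<open>1 / m n\<close> and extend to the right of the
    interval ends, so some room beyond B0 inside I is needed. The first summand of
    \<open>m n\<close> makes every ramp end before B.\<close>
  define B where "B = B0 + e / 2"
  have B: "B \<in> I" "B > B0" using e by (auto simp: B_def dist_real_def)
  define m where "m n = 1 / (B - B0) + real n" for n
  have m: "m n > 0" "m n * (B - B0) \<ge> 1" for n
  proof -
    show "m n > 0" using B by (simp add: m_def add_pos_nonneg)
    have "m n * (B - B0) = real n * (B - B0) + 1" using B by (simp add: m_def distrib_right)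
    then show "m n * (B - B0) \<ge> 1" using B by simp
  qed
  have m_lim: "filterlim m at_top sequentially"
    unfolding m_def by (rule filterlim_tendsto_add_at_top[OF tendsto_const filterlim_real_sequentially])
  define \<phi> where "\<phi> n y = (S (m n * (y - p)) - S (m n * (y - q))) / (q - p)
      - (S (m n * (y - r)) - S (m n * (y - s))) / (s - r)" for n y
  define f where "f n y = ((T (m n * (y - p)) - T (m n * (y - q))) / (q - p)
      - (T (m n * (y - r)) - T (m n * (y - s))) / (s - r)) / m n" for n y
  define \<phi>' where "\<phi>' y = indicat_real {p<..q} y / (q - p) - indicat_real {r<..s} y / (s - r)" for y
  have S_lim: "(\<lambda>n. S (m n * (y - a))) \<longlonglongrightarrow> indicat_real {a<..} y" for y a
  proof (cases "y > a")
    case True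
    have "filterlim (\<lambda>n. m n * (y - a)) at_top sequentially"
      using True by (intro filterlim_at_top_mult_tendsto_pos[OF tendsto_const _ m_lim]) auto
    then have "eventually (\<lambda>n. m n * (y - a) \<ge> 1) sequentially"
      by (simp add: filterlim_at_top)
    then have "eventually (\<lambda>n. S (m n * (y - a)) = 1) sequentially"
      by eventually_elim (rule S(4))
    then show ?thesis using True by (simp add: tendsto_eventually)
  next
    case False
    then have "m n * (y - a) \<le> 0" for n
      using m(1)[of n] by (simp add: mult_le_0_iff)
    then show ?thesis using False S(3) by simp
  qed
  have \<phi>_lim: "(\<lambda>n. \<phi> n y) \<longlonglongrightarrow> \<phi>' y" for y
  proof -
    have "(\<lambda>n. \<phi> n y) \<longlonglongrightarrow> (indicat_real {p<..} y - indicat_real {q<..} y) / (q - p)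
        - (indicat_real {r<..} y - indicat_real {s<..} y) / (s - r)"
      unfolding \<phi>_def using pq rs by (intro tendsto_intros S_lim) auto
    moreover have "(indicat_real {p<..} y - indicat_real {q<..} y) / (q - p)
        - (indicat_real {r<..} y - indicat_real {s<..} y) / (s - r) = \<phi>' y"
      using pq rs by (auto simp: \<phi>'_def indicator_def)
    ultimately show ?thesis by simp
  qed
  have f_deriv: "(f n has_real_derivative \<phi> n y) (at y)" for n y
  proof -
    have T': "((\<lambda>y. T (m n * (y - a))) has_real_derivative m n * S (m n * (y - a))) (at y)" for a
    proof -
      have "((\<lambda>y. m n * (y - a)) has_real_derivative m n) (at y)"
        by (auto intro!: derivative_eq_intros)
      from DERIV_chain2[OF T(2) this] show ?thesis by (simp add: mult.commute)
    qed
    have scale: "((\<mu> * a - \<mu> * b) / c - (\<mu> * a' - \<mu> * b') / d) / \<mu> = (a - b) / c - (a' - b') / d"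
      if "\<mu> > 0" for \<mu> a b a' b' c d :: real
      using that by (simp add: right_diff_distrib[symmetric] diff_divide_distrib)
    have "(f n has_real_derivative
        ((m n * S (m n * (y - p)) - m n * S (m n * (y - q))) / (q - p)
       - (m n * S (m n * (y - r)) - m n * S (m n * (y - s))) / (s - r)) / m n) (at y)"
      unfolding f_def by (intro DERIV_cdivide DERIV_diff T')
    then show ?thesis
      unfolding \<phi>_def scale[OF m(1)] .
  qed
  have f_smooth: "smooth (f n)" for n
  proof -
    have T': "smooth (\<lambda>y. c * T (m n * (y - a)))" for c a
      using smooth_affine_comp[OF T(1), of c "m n" "- m n * a"] by (simp add: algebra_simps)
    have "smooth (\<lambda>y. (1 / (q - p) / m n) * T (m n * (y - p)) - (1 / (q - p) / m n) * T (m n * (y - q))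
       - ((1 / (s - r) / m n) * T (m n * (y - r)) - (1 / (s - r) / m n) * T (m n * (y - s))))"
      by (intro smooth_diff T')
    then show ?thesis
      unfolding f_def by (simp add: diff_divide_distrib mult.commute)
  qed
  have f_supp: "f n y = 0" if "y \<notin> {A..B}" for n y
  proof (cases "y < A")
    case True
    then have "m n * (y - a) \<le> 0" if "a \<ge> A" for a
      using m(1)[of n] that by (simp add: mult_le_0_iff)
    then show ?thesis
      unfolding f_def using T(3) pq rs by (simp add: A_def)
  next
    case False
    then have y: "y > B" using that by auto
    have "m n * (y - a) \<ge> 1" if "a \<le> B0" for a
    proof -
      have "m n * (B - B0) \<le> m n * (y - a)"
        using m(1)[of n] y that by (intro mult_left_mono) auto
      then show ?thesis using m(2)[of n] by simp
    qed
    then have Ta: "T (m n * (y - a)) = m n * (y - a) - \<kappa>" if "a \<le> B0" for a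
      using T(4) that by blast
    \<comment> \<open>All four pieces are in their linear range here; the offsets \<kappa> cancel
      and both quotients equal \<open>m n\<close>.\<close>
    have "f n y = ((m n * (q - p)) / (q - p) - (m n * (s - r)) / (s - r)) / m n"
    proof -
      have "T (m n * (y - p)) - T (m n * (y - q)) = m n * (q - p)"
        "T (m n * (y - r)) - T (m n * (y - s)) = m n * (s - r)"
        using pq rs by (simp_all add: Ta B0_def) (simp_all add: algebra_simps)
      then show ?thesis unfolding f_def by simp
    qed
    then show ?thesis using pq rs by simp
  qed
  have w_int: "integrable lborel (\<lambda>y. indicat_real {A..B} y *\<^sub>R w y)"
    using w[OF AB(1) B(1)] by (simp add: set_integrable_def)
  have zero: "(LINT y|lborel. \<phi> n y *\<^sub>R (indicat_real {A..B} y *\<^sub>R w y)) = 0" for n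
  proof -
    have "(LINT y:{A..B}|lborel. deriv (f n) y *\<^sub>R w y) = 0"
      using weak[OF f_smooth AB(1) B(1) f_supp] by blast
    moreover have "deriv (f n) = \<phi> n"
      using f_deriv by (intro ext DERIV_imp_deriv)
    ultimately show ?thesis
      unfolding set_lebesgue_integral_def by (simp add: mult.commute)
  qed
  have [measurable]: "S \<in> borel_measurable borel"
  proof -
    have "S = deriv T" using DERIV_imp_deriv[OF T(2)] by (intro ext) simp
    then show ?thesis
      using smooth_continuous[OF smooth_deriv[OF T(1)]] by (simp add: borel_measurable_continuous_onI)
  qed
  \<comment> \<open>Differences of S lie between -1 and 1, so c bounds \<open>\<phi> n\<close>
    uniformly in n.\<close>
  define c where "c = 1 / (q - p) + 1 / (s - r)"
  have "(\<lambda>n. LINT y|lborel. \<phi> n y *\<^sub>R (indicat_real {A..B} y *\<^sub>R w y))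
      \<longlonglongrightarrow> (LINT y|lborel. \<phi>' y *\<^sub>R (indicat_real {A..B} y *\<^sub>R w y))"
  proof (rule integral_dominated_convergence)
    have [measurable]: "(\<lambda>y. indicat_real {A..B} y *\<^sub>R w y) \<in> borel_measurable lborel"
      using w_int by (rule borel_measurable_integrable)
    show "(\<lambda>y. \<phi>' y *\<^sub>R (indicat_real {A..B} y *\<^sub>R w y)) \<in> borel_measurable lborel"
      "(\<lambda>y. \<phi> n y *\<^sub>R (indicat_real {A..B} y *\<^sub>R w y)) \<in> borel_measurable lborel" for n
      unfolding \<phi>'_def \<phi>_def by measurable
    show "integrable lborel (\<lambda>y. c * norm (indicat_real {A..B} y *\<^sub>R w y))"
      using w_int by (intro integrable_mult_right integrable_norm)
    show "AE y in lborel. (\<lambda>n. \<phi> n y *\<^sub>R (indicat_real {A..B} y *\<^sub>R w y))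
        \<longlonglongrightarrow> \<phi>' y *\<^sub>R (indicat_real {A..B} y *\<^sub>R w y)"
      using \<phi>_lim by (intro AE_I2 tendsto_scaleR tendsto_const)
    show "AE y in lborel. norm (\<phi> n y *\<^sub>R (indicat_real {A..B} y *\<^sub>R w y))
        \<le> c * norm (indicat_real {A..B} y *\<^sub>R w y)" for n
    proof (intro AE_I2)
      fix y
      have "\<bar>S a - S b\<bar> \<le> 1" for a b
        using S(1)[of a] S(1)[of b] S(2)[of a] S(2)[of b] by linarith
      then have "\<bar>(S a - S b) / d\<bar> \<le> 1 / d" if "d > 0" for a b d
        using that by (simp add: divide_right_mono)
      then have "\<bar>\<phi> n y\<bar> \<le> c"
        unfolding \<phi>_def c_def using pq rs by (intro order_trans[OF abs_triangle_ineq4] add_mono) auto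
      then show "norm (\<phi> n y *\<^sub>R (indicat_real {A..B} y *\<^sub>R w y)) \<le> c * norm (indicat_real {A..B} y *\<^sub>R w y)"
        unfolding norm_scaleR by (intro mult_right_mono) auto
    qed
  qed
  then have lim0: "(LINT y|lborel. \<phi>' y *\<^sub>R (indicat_real {A..B} y *\<^sub>R w y)) = 0"
    unfolding zero by (simp add: LIMSEQ_const_iff)
  have sub: "{p<..q} \<subseteq> {A..B}" "{r<..s} \<subseteq> {A..B}"
    using B by (auto simp: A_def B0_def)
  have si: "set_integrable lborel {p<..q} w" "set_integrable lborel {r<..s} w"
    using sub by (auto intro: set_integrable_subset[OF w[OF AB(1) B(1)]])
  have "\<phi>' y *\<^sub>R (indicat_real {A..B} y *\<^sub>R w y)
     = (indicat_real {p<..q} y *\<^sub>R w y) /\<^sub>R (q - p) - (indicat_real {r<..s} y *\<^sub>R w y) /\<^sub>R (s - r)" for y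
    using sub by (auto simp: \<phi>'_def indicator_def scaleR_diff_left divide_inverse)
  then have "(LINT y|lborel. \<phi>' y *\<^sub>R (indicat_real {A..B} y *\<^sub>R w y))
     = (LINT y|lborel. (indicat_real {p<..q} y *\<^sub>R w y) /\<^sub>R (q - p) - (indicat_real {r<..s} y *\<^sub>R w y) /\<^sub>R (s - r))"
    by (simp only:)
  also have "\<dots> = (LINT y:{p<..q}|lborel. w y) /\<^sub>R (q - p) - (LINT y:{r<..s}|lborel. w y) /\<^sub>R (s - r)"
    using si unfolding set_lebesgue_integral_def set_integrable_def integral_scaleR_right[symmetric]
    by (intro Bochner_Integration.integral_diff integrable_scaleR_right)
  finally have "(LINT y|lborel. \<phi>' y *\<^sub>R (indicat_real {A..B} y *\<^sub>R w y))
     = (LINT y:{p<..q}|lborel. w y) /\<^sub>R (q - p) - (LINT y:{r<..s}|lborel. w y) /\<^sub>R (s - r)" .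
  with lim0 show ?thesis by simp
qed

text \<open>Let C be the average of w over one reference interval. As all averages agree, w - C
  integrates to zero over every interval inside I; truncation to such an interval turns ray
  integrals into integrals of this kind.\<close>

lemma du_bois_reymond:
  fixes w :: "real \<Rightarrow> complex"
  assumes I: "open I" "is_interval I"
    and w: "\<And>p q. p \<in> I \<Longrightarrow> q \<in> I \<Longrightarrow> set_integrable lborel {p..q} w"
    and weak: "\<And>f p q. smooth f \<Longrightarrow> p \<in> I \<Longrightarrow> q \<in> I \<Longrightarrow> (\<And>x. x \<notin> {p..q} \<Longrightarrow> f x = 0) \<Longrightarrow>
        (LINT y:{p..q}|lborel. deriv f y *\<^sub>R w y) = 0"
  shows "\<exists>C. AE y in lborel. y \<in> I \<longrightarrow> w y = C"
proof (cases "\<exists>r s. r \<in> I \<and> s \<in> I \<and> r < s")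
  case True
  then obtain r s where rs: "r \<in> I" "s \<in> I" "r < s" by blast
  define C where "C = (LINT y:{r<..s}|lborel. w y) /\<^sub>R (s - r)"
  have si: "set_integrable lborel {p<..q} w" if "p \<in> I" "q \<in> I" for p q
    by (rule set_integrable_subset[OF w[OF that]]) auto
  have siC: "set_integrable lborel {p<..q} (\<lambda>y. C)" for p q :: real
    unfolding set_integrable_def
    by (intro integrable_scaleR_left integrable_real_indicator; cases "p \<le> q") simp_all
  have zero: "(LINT y:{p<..q}|lborel. w y - C) = 0" if "p \<in> I" "q \<in> I" for p q
  proof (cases "p < q")
    case True
    have "(LINT y:{p<..q}|lborel. w y) /\<^sub>R (q - p) = C"
      unfolding C_def
      by (rule averages_eq_if_weakly_constant[OF I(1) _ _ that True rs]) (use w weak in blast)+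
    then have "(LINT y:{p<..q}|lborel. w y) = (q - p) *\<^sub>R C"
      using True by auto
    moreover have "(LINT y:{p<..q}|lborel. C) = (q - p) *\<^sub>R C"
      using True by (simp add: set_lebesgue_integral_def)
    ultimately show ?thesis using set_integral_diff(2)[OF si[OF that] siC] by simp
  qed (simp add: set_lebesgue_integral_def)
  have local: "AE y in lborel. y \<in> {p<..q} \<longrightarrow> w y = C" if pq: "p \<in> I" "q \<in> I" for p q
  proof -
    have "AE y in lborel. indicat_real {p<..q} y *\<^sub>R (w y - C) = 0"
    proof (rule AE_zero_if_ray_integrals_zero)
      show "integrable lborel (\<lambda>y. indicat_real {p<..q} y *\<^sub>R (w y - C))"
        using set_integral_diff(1)[OF si[OF pq] siC] by (simp add: set_integrable_def)
      show "(LINT y|lborel. indicat_real {p<..q} y *\<^sub>R (w y - C)) = 0"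
        using zero[OF pq] by (simp add: set_lebesgue_integral_def)
      fix a
      have "(LINT y:{a<..}|lborel. indicat_real {p<..q} y *\<^sub>R (w y - C)) = (LINT y:{max a p<..q}|lborel. w y - C)"
        unfolding set_lebesgue_integral_def
        by (rule Bochner_Integration.integral_cong) (simp_all add: indicator_def)
      also have "\<dots> = 0"
      proof (cases "max a p \<le> q")
        case True
        then have "max a p \<in> I"
          using pq I(2) max.cobounded2[of p a] unfolding is_interval_1 by blast
        then show ?thesis using zero pq by blast
      next
        case False
        then have "{max a p<..q} = {}" by auto
        then show ?thesis by (simp only: set_lebesgue_integral_def) simp
      qed
      finally show "(LINT y:{a<..}|lborel. indicat_real {p<..q} y *\<^sub>R (w y - C)) = 0" .
    qed
    then show ?thesis by eventually_elim (auto simp: indicator_def)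
  qed
  \<comment> \<open>Rational end points leave only countably many exceptional null sets.\<close>
  have "AE y in lborel. \<forall>p\<in>\<rat>. \<forall>q\<in>\<rat>. p \<in> I \<and> q \<in> I \<longrightarrow> y \<in> {p<..q} \<longrightarrow> w y = C"
    using local by (simp add: AE_ball_countable countable_rat)
  then have "AE y in lborel. y \<in> I \<longrightarrow> w y = C"
  proof eventually_elim
    case (elim y)
    show ?case
    proof
      assume "y \<in> I"
      then obtain e where e: "e > 0" "\<And>x. dist x y < e \<Longrightarrow> x \<in> I"
        using I(1) unfolding open_dist by blast
      obtain p where p: "p \<in> \<rat>" "y - e < p" "p < y" using Rats_dense_in_real[of "y - e" y] e by auto
      obtain q where q: "q \<in> \<rat>" "y < q" "q < y + e" using Rats_dense_in_real[of y "y + e"] e by auto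
      have "p \<in> I" "q \<in> I" using p q by (auto intro!: e(2) simp: dist_real_def)
      with elim p q show "w y = C" by auto
    qed
  qed
  then show ?thesis by blast
next
  case False
  have "I = {}"
  proof (rule ccontr)
    assume "I \<noteq> {}"
    then obtain x where "x \<in> I" by blast
    then obtain e where "e > 0" "\<And>y. dist y x < e \<Longrightarrow> y \<in> I" using I(1) unfolding open_dist by blast
    then have "x + e / 2 \<in> I" by (auto simp: dist_real_def)
    with False \<open>x \<in> I\<close> \<open>e > 0\<close> show False by (metis field_sum_of_halves less_add_same_cancel1 half_gt_zero)
  qed
  then show ?thesis by simp
qed

section \<open>Functions on the fundamental domain\<close>

text \<open>Three versions of the base are kept apart. The carrier supports the measure, the
  interior contains the supports of local test functions, and the closure, with both ends of the
  circle, is where solutions are differentiated, one-sidedly at those ends.\<close>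

fun base_carrier :: "base \<Rightarrow> real set" where
  "base_carrier Line = UNIV"
| "base_carrier Circle = {0..<2 * pi}"

fun base_closure :: "base \<Rightarrow> real set" where
  "base_closure Line = UNIV"
| "base_closure Circle = {0..2 * pi}"

fun base_interior :: "base \<Rightarrow> real set" where
  "base_interior Line = UNIV"
| "base_interior Circle = {0<..<2 * pi}"

text \<open>Extension by zero lets integrals be taken with respect to \<open>lborel\<close>; off the
  fundamental domain u is arbitrary and need not even be measurable.\<close>

definition base_cut :: "base \<Rightarrow> (real \<Rightarrow> complex) \<Rightarrow> real \<Rightarrow> complex" where
  "base_cut Y u y = indicat_real (base_carrier Y) y *\<^sub>R u y"

lemma base_carrier_sets [measurable, simp]: "base_carrier Y \<in> sets borel"
  by (cases Y) auto

lemma base_measure_eq: "base_measure Y = restrict_space lborel (base_carrier Y)"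
proof (cases Y)
  case Line
  have "restrict_space lborel UNIV = (lborel :: real measure)"
    by (rule measure_eqI) (simp_all add: sets_restrict_space emeasure_restrict_space)
  with Line show ?thesis by simp
qed simp

lemma integral_base_measure:
  fixes f :: "real \<Rightarrow> 'a :: {banach, second_countable_topology}"
  shows "(LINT y|base_measure Y. f y) = (LINT y:base_carrier Y|lborel. f y)"
  by (simp add: base_measure_eq integral_restrict_space set_lebesgue_integral_def)

lemma integrable_base_measure:
  fixes f :: "real \<Rightarrow> 'a :: {banach, second_countable_topology}"
  shows "integrable (base_measure Y) f \<longleftrightarrow> set_integrable lborel (base_carrier Y) f"
  by (simp add: base_measure_eq integrable_restrict_space set_integrable_def)

lemma AE_base_measure:
  "(AE y in base_measure Y. P y) \<longleftrightarrow> (AE y in lborel. y \<in> base_carrier Y \<longrightarrow> P y)"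
  unfolding base_measure_eq by (rule AE_restrict_space_iff) simp

lemma borel_measurable_base_measure:
  fixes f :: "real \<Rightarrow> complex"
  shows "f \<in> borel_measurable (base_measure Y) \<longleftrightarrow> base_cut Y f \<in> borel_measurable lborel"
  by (simp add: base_measure_eq borel_measurable_restrict_space_iff base_cut_def[abs_def])

lemma L2_base_cut:
  assumes "u \<in> L2 Y"
  shows "base_cut Y u \<in> borel_measurable lborel" "integrable lborel (\<lambda>y. (cmod (base_cut Y u y))\<^sup>2)"
proof -
  show "base_cut Y u \<in> borel_measurable lborel"
    using assms borel_measurable_base_measure by (auto simp: L2_def)
  have "integrable lborel (\<lambda>y. indicat_real (base_carrier Y) y *\<^sub>R (cmod (u y))\<^sup>2)"
    using assms unfolding L2_def integrable_base_measure set_integrable_def by simp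
  moreover have "indicat_real (base_carrier Y) y *\<^sub>R (cmod (u y))\<^sup>2 = (cmod (base_cut Y u y))\<^sup>2" for y
    by (simp add: base_cut_def indicator_def)
  ultimately show "integrable lborel (\<lambda>y. (cmod (base_cut Y u y))\<^sup>2)" by simp
qed

lemma L2_locally_integrable:
  assumes "u \<in> L2 Y"
  shows "set_integrable lborel {p..q} (base_cut Y u)"
  unfolding set_integrable_def
proof (rule Bochner_Integration.integrable_bound)
  note [measurable] = L2_base_cut(1)[OF assms]
  have "integrable lborel (\<lambda>y. indicat_real {p..q} y *\<^sub>R (1::real))"
    by (intro integrable_scaleR_left integrable_real_indicator; cases "p \<le> q") simp_all
  then show "integrable lborel (\<lambda>y. indicat_real {p..q} y *\<^sub>R (1::real) + (cmod (base_cut Y u y))\<^sup>2)"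
    using L2_base_cut(2)[OF assms] by (rule Bochner_Integration.integrable_add)
  show "(\<lambda>y. indicat_real {p..q} y *\<^sub>R base_cut Y u y) \<in> borel_measurable lborel"
    by measurable
  have "t \<le> 1 + t\<^sup>2" if "t \<ge> 0" for t :: real
    using zero_le_power2[of "t - 1/2"] by (simp add: power2_eq_square algebra_simps)
  then show "AE y in lborel. norm (indicat_real {p..q} y *\<^sub>R base_cut Y u y)
      \<le> norm (indicat_real {p..q} y *\<^sub>R (1::real) + (cmod (base_cut Y u y))\<^sup>2)"
    by (intro AE_I2) (simp add: indicator_def)
qed

section \<open>Testing weak derivatives inside the fundamental domain\<close>

lemma vanishes_at_ends:
  fixes f :: "real \<Rightarrow> 'a :: real_normed_vector"
  assumes "continuous_on UNIV f" "\<And>x. x \<notin> {p..q} \<Longrightarrow> f x = 0"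
  shows "f p = 0" "f q = 0"
proof -
  have "closed {x. f x = 0}"
    using assms(1) by (intro closed_Collect_eq continuous_on_const)
  then have "closure {..<p} \<subseteq> {x. f x = 0}" "closure {q<..} \<subseteq> {x. f x = 0}"
    using assms(2) by (intro closure_minimal; auto)+
  then show "f p = 0" "f q = 0" by auto
qed

lemma deriv_vanishes_outside:
  assumes "\<And>x. x \<notin> {p..q} \<Longrightarrow> f x = (0::real)" "x \<notin> {p..q}"
  shows "deriv f x = 0"
proof -
  have "(f has_real_derivative 0) (at x)"
    by (rule has_field_derivative_transform_within_open[of "\<lambda>_. 0" _ _ "- {p..q}"])
       (use assms in auto)
  then show ?thesis by (rule DERIV_imp_deriv)
qed

text \<open>v is merely integrable, so U need not be differentiable everywhere. Instead of the
  product rule, the order of integration over the triangle \<open>s \<le> y\<close> is exchanged by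
  Fubini.\<close>

lemma antiderivative_by_parts:
  fixes v :: "real \<Rightarrow> complex"
  assumes pq: "p \<le> q" and v: "set_integrable lborel {p..q} v"
    and U: "\<And>y. y \<in> {p..q} \<Longrightarrow> U y = c + (LINT s:{p..y}|lborel. v s)"
    and f: "smooth f" "f p = 0" "f q = 0"
  shows "(LINT y:{p..q}|lborel. deriv f y *\<^sub>R U y) = - (LINT y:{p..q}|lborel. f y *\<^sub>R v y)"
proof -
  define g where "g y = indicat_real {p..q} y *\<^sub>R deriv f y" for y
  define vv where "vv s = indicat_real {p..q} s *\<^sub>R v s" for s
  have cont: "continuous_on S (deriv f)" for S
    by (intro smooth_continuous smooth_deriv f)
  have g_int: "integrable lborel g"
    unfolding g_def using borel_integrable_compact[OF compact_Icc cont] .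
  have vv_int: "integrable lborel vv"
    using v unfolding vv_def set_integrable_def .
  note [measurable] = borel_measurable_integrable[OF g_int] borel_measurable_integrable[OF vv_int]
  have g_tail: "(LINT y:{s..}|lborel. g y) = - f s" if "s \<in> {p..q}" for s
  proof -
    have "(LINT y:{s..}|lborel. g y) = (LINT y:{s..q}|lborel. deriv f y)"
      unfolding set_lebesgue_integral_def g_def
      by (rule Bochner_Integration.integral_cong) (use that in \<open>simp_all add: indicator_def\<close>)
    also have "\<dots> = f q - f s"
      unfolding set_lebesgue_integral_def
    proof (rule integral_FTC_atLeastAtMost)
      show "(f has_vector_derivative deriv f x) (at x within {s..q})" for x
        unfolding has_real_derivative_iff_has_vector_derivative[symmetric]
        by (rule has_field_derivative_at_within[OF smooth_has_deriv[OF f(1)]])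
    qed (use that cont in auto)
    finally show ?thesis using f by simp
  qed
  have prod_int: "integrable (lborel \<Otimes>\<^sub>M lborel) (\<lambda>(s, y). (indicat_real {s..} y * g y) *\<^sub>R vv s)"
  proof (rule Bochner_Integration.integrable_bound)
    show "integrable (lborel \<Otimes>\<^sub>M lborel) (\<lambda>(s, y). g y *\<^sub>R vv s)"
    proof (rule lborel_pair.Fubini_integrable)
      show "(\<lambda>(s, y). g y *\<^sub>R vv s) \<in> borel_measurable (lborel \<Otimes>\<^sub>M lborel)" by measurable
      have "(\<integral> y. norm (case (s, y) of (s, y) \<Rightarrow> g y *\<^sub>R vv s) \<partial>lborel) = (\<integral> y. \<bar>g y\<bar> \<partial>lborel) * norm (vv s)" for s
        by simp
      then show "integrable lborel (\<lambda>s. \<integral> y. norm (case (s, y) of (s, y) \<Rightarrow> g y *\<^sub>R vv s) \<partial>lborel)"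
        using vv_int by simp
      show "AE s in lborel. integrable lborel (\<lambda>y. case (s, y) of (s, y) \<Rightarrow> g y *\<^sub>R vv s)"
        using g_int by simp
    qed
    have "Measurable.pred (lborel \<Otimes>\<^sub>M lborel) (\<lambda>z :: real \<times> real. fst z \<le> snd z)" by measurable
    then have "{z :: real \<times> real. fst z \<le> snd z} \<in> sets (lborel \<Otimes>\<^sub>M lborel)"
      by (simp add: pred_def space_pair_measure)
    then have "indicat_real {z :: real \<times> real. fst z \<le> snd z} \<in> borel_measurable (lborel \<Otimes>\<^sub>M lborel)"
      by (rule borel_measurable_indicator)
    moreover have "indicat_real {z :: real \<times> real. fst z \<le> snd z} = (\<lambda>(s :: real, y). indicat_real {s..} y)"
      by (auto simp: indicator_def fun_eq_iff)
    ultimately have [measurable]: "(\<lambda>(s :: real, y). indicat_real {s..} y) \<in> borel_measurable (lborel \<Otimes>\<^sub>M lborel)"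
      by simp
    show "(\<lambda>(s, y). (indicat_real {s..} y * g y) *\<^sub>R vv s) \<in> borel_measurable (lborel \<Otimes>\<^sub>M lborel)"
      by measurable
    show "AE z in lborel \<Otimes>\<^sub>M lborel. norm (case z of (s, y) \<Rightarrow> (indicat_real {s..} y * g y) *\<^sub>R vv s)
        \<le> norm (case z of (s, y) \<Rightarrow> g y *\<^sub>R vv s)"
      by (intro AE_I2) (auto simp: indicator_def)
  qed
  have inner_s: "(\<integral>s. (indicat_real {s..} y * g y) *\<^sub>R vv s \<partial>lborel) = g y *\<^sub>R (U y - c)" for y
  proof (cases "y \<in> {p..q}")
    case True
    have "(\<integral>s. (indicat_real {s..} y * g y) *\<^sub>R vv s \<partial>lborel)
        = (\<integral>s. g y *\<^sub>R (indicat_real {p..y} s *\<^sub>R v s) \<partial>lborel)"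
      by (rule Bochner_Integration.integral_cong) (use True in \<open>auto simp: indicator_def vv_def\<close>)
    also have "\<dots> = g y *\<^sub>R (U y - c)"
      unfolding integral_scaleR_right using U[OF True] by (simp add: set_lebesgue_integral_def)
    finally show ?thesis .
  qed (simp add: g_def)
  have inner_y: "(\<integral>y. (indicat_real {s..} y * g y) *\<^sub>R vv s \<partial>lborel) = - (f s *\<^sub>R vv s)" for s
  proof (cases "s \<in> {p..q}")
    case True
    have "(\<integral>y. (indicat_real {s..} y * g y) *\<^sub>R vv s \<partial>lborel) = (\<integral>y. indicat_real {s..} y * g y \<partial>lborel) *\<^sub>R vv s"
      using integrable_mult_indicator[OF _ g_int, of "{s..}"] by (intro integral_scaleR_left) auto
    then show ?thesis using g_tail[OF True] by (simp add: set_lebesgue_integral_def)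
  qed (simp add: vv_def)
  have "(\<integral>y. g y *\<^sub>R (U y - c) \<partial>lborel) = (\<integral>s. - (f s *\<^sub>R vv s) \<partial>lborel)"
    using lborel_pair.Fubini_integral[OF prod_int] unfolding inner_s inner_y .
  moreover have "(\<integral>y. g y *\<^sub>R (U y - c) \<partial>lborel) = (LINT y:{p..q}|lborel. deriv f y *\<^sub>R U y)"
  proof -
    have gU: "integrable lborel (\<lambda>y. g y *\<^sub>R (U y - c))"
      using lborel_pair.integrable_snd[OF prod_int] unfolding inner_s .
    have gc: "integrable lborel (\<lambda>y. g y *\<^sub>R c)"
      using g_int by simp
    \<comment> \<open>f vanishes at both ends, so g has integral zero and the constant c drops
      out.\<close>
    have "(\<integral>y. g y \<partial>lborel) = (LINT y:{p..}|lborel. g y)"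
      unfolding set_lebesgue_integral_def
      by (rule Bochner_Integration.integral_cong) (auto simp: indicator_def g_def)
    also have "\<dots> = 0" using g_tail[of p] pq f by simp
    finally have g0: "(\<integral>y. g y \<partial>lborel) = 0" .
    have "(\<integral>y. g y *\<^sub>R U y \<partial>lborel) = (\<integral>y. g y *\<^sub>R (U y - c) + g y *\<^sub>R c \<partial>lborel)"
      by (simp add: scaleR_diff_right)
    also have "\<dots> = (\<integral>y. g y *\<^sub>R (U y - c) \<partial>lborel) + (\<integral>y. g y \<partial>lborel) *\<^sub>R c"
      using gU gc g_int by simp
    finally show ?thesis
      using g0 by (simp add: g_def set_lebesgue_integral_def)
  qed
  moreover have "(\<integral>s. - (f s *\<^sub>R vv s) \<partial>lborel) = - (LINT y:{p..q}|lborel. f y *\<^sub>R v y)"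
    by (simp add: vv_def set_lebesgue_integral_def mult.commute)
  ultimately show ?thesis by simp
qed

text \<open>Folding by the floor function makes F periodic, and F is smooth across the multiples of
  2 pi because f vanishes near both ends of the fundamental domain.\<close>

lemma periodic_extension:
  assumes f: "smooth f" and pq: "0 < p" "q < 2 * pi" and supp: "\<And>x. x \<notin> {p..q} \<Longrightarrow> f x = 0"
  shows "\<exists>F. test_function Circle F \<and> (\<forall>x\<in>{0..<2 * pi}. F x = f x \<and> deriv F x = deriv f x)"
proof -
  define F where "F x = f (x - 2 * pi * of_int \<lfloor>x / (2 * pi)\<rfloor>)" for x
  \<comment> \<open>On the open window from -m to 2 pi, longer than a period, F agrees with f: left
    of 0 both vanish, since the fold lands to the right of q. Translates of the window cover the
    line. The bound \<open>m \<le> 2 * pi\<close> makes the floor equal to -1 on its negative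
    part.\<close>
  define m where "m = min p (min (2 * pi - q) (2 * pi))"
  have m: "m > 0" "m \<le> 2 * pi" using pq by (simp_all add: m_def)
  have F_per: "F (x + 2 * pi * of_int k) = F x" for x k
    unfolding F_def by (simp add: add_divide_distrib algebra_simps)
  have F_eq: "F x = f x" if "x \<in> {-m<..<2 * pi}" for x
  proof (cases "x < 0")
    case True
    have "\<lfloor>x / (2 * pi)\<rfloor> = -1"
    proof (rule floor_unique)
      show "of_int (- 1) \<le> x / (2 * pi)" using that m(2) by (simp add: field_simps)
      show "x / (2 * pi) < of_int (- 1) + 1" using True by (simp add: field_simps)
    qed
    then have "F x = f (x + 2 * pi)" by (simp add: F_def)
    also have "\<dots> = 0" using that by (intro supp) (auto simp: m_def)
    also have "\<dots> = f x" using supp[of x] True pq by simp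
    finally show ?thesis .
  next
    case False
    have "\<lfloor>x / (2 * pi)\<rfloor> = 0"
      using that False by (intro floor_unique) (auto simp: field_simps)
    then show ?thesis by (simp add: F_def)
  qed
  have "smooth F"
  proof (rule smooth_local)
    fix x
    define k where "k = \<lfloor>x / (2 * pi)\<rfloor>"
    define S where "S = {2 * pi * k - m<..<2 * pi * k + 2 * pi}"
    have "of_int k \<le> x / (2 * pi)" "x / (2 * pi) < of_int k + 1"
      unfolding k_def by linarith+
    then have x: "x \<in> S"
      using m by (auto simp: S_def field_simps)
    have "F y = f (1 * y + (- 2 * pi * k))" if "y \<in> S" for y
    proof -
      have "F y = F (y - 2 * pi * k)" using F_per[of "y - 2 * pi * k" k] by simp
      also have "\<dots> = f (y - 2 * pi * k)" using that by (intro F_eq) (auto simp: S_def)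
      finally show ?thesis by simp
    qed
    moreover have "smooth (\<lambda>y. f (1 * y + (- 2 * pi * k)))"
      using smooth_affine_comp[OF f, of 1 1 "- 2 * pi * k"] by simp
    moreover have "open S" by (simp add: S_def)
    ultimately show "\<exists>S g. open S \<and> x \<in> S \<and> smooth g \<and> (\<forall>y\<in>S. F y = g y)"
      using x by blast
  qed
  moreover have "F (x + 2 * pi) = F x" for x
    using F_per[of x 1] by simp
  moreover have "deriv F x = deriv f x" if "x \<in> {0..<2 * pi}" for x
  proof (rule DERIV_imp_deriv, rule has_field_derivative_transform_within_open[OF smooth_has_deriv[OF f]])
    show "open {-m<..<2 * pi}" by simp
    show "x \<in> {-m<..<2 * pi}" using that m by auto
    show "\<And>y. y \<in> {-m<..<2 * pi} \<Longrightarrow> f y = F y" using F_eq by simp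
  qed
  moreover have "F x = f x" if "x \<in> {0..<2 * pi}" for x
    using that m by (intro F_eq) auto
  ultimately show ?thesis by auto
qed

text \<open>Brings both bases to the same local identity. On the circle the test function is
  periodised first, without changing it or its derivative on the fundamental domain.\<close>

lemma weak_deriv_local_test:
  assumes uv: "has_weak_deriv Y u v" and f: "smooth f" and pq: "p \<in> base_interior Y" "q \<in> base_interior Y"
    and supp: "\<And>x. x \<notin> {p..q} \<Longrightarrow> f x = 0"
  shows "(LINT y:{p..q}|lborel. deriv f y *\<^sub>R base_cut Y u y) = - (LINT y:{p..q}|lborel. f y *\<^sub>R base_cut Y v y)"
proof -
  obtain F where F: "test_function Y F" "\<And>x. x \<in> base_carrier Y \<Longrightarrow> F x = f x \<and> deriv F x = deriv f x"
  proof (cases Y)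
    case Line
    have "closure {x. f x \<noteq> 0} \<subseteq> {p..q}"
      using supp by (intro closure_minimal) (blast, simp)
    then have "compact (closure {x. f x \<noteq> 0})"
      using compact_Int_closed[of "{p..q}" "closure {x. f x \<noteq> 0}"] by (simp add: Int_absorb1)
    with Line f show ?thesis by (intro that[of f]) auto
  next
    case Circle
    with periodic_extension[OF f, of p q] pq supp show ?thesis
      by (auto intro: that)
  qed
  have restrict: "(LINT y|base_measure Y. a y * complex_of_real (b' y)) = (LINT y:{p..q}|lborel. b y *\<^sub>R base_cut Y a y)"
    if "\<And>x. x \<in> base_carrier Y \<Longrightarrow> b' x = b x" "\<And>x. x \<notin> {p..q} \<Longrightarrow> b x = 0" for a b b'
    unfolding integral_base_measure set_lebesgue_integral_def
    by (rule Bochner_Integration.integral_cong)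
       (use that in \<open>auto simp: base_cut_def scaleR_conv_of_real indicator_def\<close>)
  have "(LINT y:{p..q}|lborel. deriv f y *\<^sub>R base_cut Y u y) = (LINT y|base_measure Y. u y * complex_of_real (deriv F y))"
    by (rule restrict[symmetric]) (use F deriv_vanishes_outside[OF supp] in auto)
  also have "\<dots> = - (LINT y|base_measure Y. v y * complex_of_real (F y))"
    using uv F(1) unfolding has_weak_deriv_def by blast
  also have "(LINT y|base_measure Y. v y * complex_of_real (F y)) = (LINT y:{p..q}|lborel. f y *\<^sub>R base_cut Y v y)"
    by (rule restrict) (use F supp in auto)
  finally show ?thesis .
qed

text \<open>The constant 1 is a periodic test function that does not arise from local ones. Its
  identity is what makes the continuous representative match at 0 and 2 pi.\<close>

lemma weak_deriv_circle_mean_zero: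
  assumes "has_weak_deriv Circle u v"
  shows "(LINT y|lborel. base_cut Circle v y) = 0"
proof -
  have "test_function Circle (\<lambda>x. 1)" by (simp add: smooth_const)
  then have "(LINT y|base_measure Circle. u y * complex_of_real (deriv (\<lambda>x. 1) y))
      = - (LINT y|base_measure Circle. v y * complex_of_real 1)"
    using assms unfolding has_weak_deriv_def by blast
  then have "(LINT y|base_measure Circle. v y) = 0" by simp
  then show ?thesis
    unfolding integral_base_measure set_lebesgue_integral_def base_cut_def .
qed

section \<open>Continuous primitives of weak derivatives\<close>

lemma primitive_exists:
  fixes v :: "real \<Rightarrow> complex"
  assumes v: "\<And>p q. set_integrable lborel {p..q} v"
  shows "\<exists>U. continuous_on UNIV U \<and> (\<forall>p q. p \<le> q \<longrightarrow> U q = U p + (LINT s:{p..q}|lborel. v s))"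
proof -
  \<comment> \<open>A signed integral from 0 to y: for either sign of y, one of the two intervals is
    empty or a point.\<close>
  define U where "U y = integral {0..y} v - integral {y..0} v" for y
  have io: "v integrable_on {p..q}" for p q
    using set_borel_integral_eq_integral(1)[OF v] .
  have U: "U q = U p + integral {p..q} v" if "p \<le> q" for p q
  proof -
    consider "0 \<le> p" | "p < 0" "0 \<le> q" | "q < 0" by linarith
    then show ?thesis
    proof cases
      case 1
      have "integral {0..p} v + integral {p..q} v = integral {0..q} v"
        using 1 that io by (intro Henstock_Kurzweil_Integration.integral_combine)
      then show ?thesis unfolding U_def using 1 that by (cases "p = 0"; cases "q = 0") (auto simp: algebra_simps)
    next
      case 2
      have "integral {p..0} v + integral {0..q} v = integral {p..q} v"
        using 2 that io by (intro Henstock_Kurzweil_Integration.integral_combine) auto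
      then show ?thesis unfolding U_def using 2 by (cases "q = 0") (auto simp: algebra_simps)
    next
      case 3
      have "integral {p..q} v + integral {q..0} v = integral {p..0} v"
        using 3 that io by (intro Henstock_Kurzweil_Integration.integral_combine) auto
      then show ?thesis unfolding U_def using 3 that by (auto simp: algebra_simps)
    qed
  qed
  have "isCont U x" for x
  proof -
    have "continuous_on {x-1..x+1} (\<lambda>y. U (x-1) + integral {x-1..y} v)"
      by (intro continuous_intros indefinite_integral_continuous_1 io)
    then have "continuous_on {x-1..x+1} U"
      by (rule continuous_on_eq) (use U[symmetric] in simp)
    then show ?thesis
      by (rule continuous_on_interior) simp
  qed
  then have "continuous_on UNIV U" by (simp add: continuous_at_imp_continuous_on)
  then show ?thesis
    using U set_borel_integral_eq_integral(2)[OF v] by auto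
qed

text \<open>By integration by parts, u and the primitive of v have the same weak derivative in the
  interior, so they differ by a constant, which is added to the primitive.\<close>

lemma weak_deriv_primitive:
  assumes uv: "has_weak_deriv Y u v"
  shows "\<exists>U. continuous_on UNIV U \<and> (AE y in base_measure Y. u y = U y) \<and>
     (\<forall>p q. p \<le> q \<longrightarrow> U q = U p + (LINT s:{p..q}|lborel. base_cut Y v s)) \<and>
     (Y = Circle \<longrightarrow> U (2 * pi) = U 0)"
proof -
  have u: "u \<in> L2 Y" and v: "v \<in> L2 Y" using uv by (auto simp: has_weak_deriv_def)
  obtain U where U: "continuous_on UNIV U" "\<And>p q. p \<le> q \<Longrightarrow> U q = U p + (LINT s:{p..q}|lborel. base_cut Y v s)"
    using primitive_exists[OF L2_locally_integrable[OF v]] by blast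
  have U_int: "set_integrable lborel {p..q} U" for p q
    unfolding set_integrable_def
    by (rule borel_integrable_compact) (use U(1) in \<open>auto intro: continuous_on_subset\<close>)
  have "\<exists>C. AE y in lborel. y \<in> base_interior Y \<longrightarrow> base_cut Y u y - U y = C"
  proof (rule du_bois_reymond)
    show "open (base_interior Y)" "is_interval (base_interior Y)"
      by (cases Y; simp add: is_interval_1)+
    show "set_integrable lborel {p..q} (\<lambda>y. base_cut Y u y - U y)" for p q
      using L2_locally_integrable[OF u] U_int by (rule set_integral_diff(1))
    fix f p q
    assume f: "smooth f" and pq: "p \<in> base_interior Y" "q \<in> base_interior Y"
      and supp: "\<And>x. x \<notin> {p..q} \<Longrightarrow> f x = (0::real)"
    show "(LINT y:{p..q}|lborel. deriv f y *\<^sub>R (base_cut Y u y - U y)) = 0"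
    proof (cases "p \<le> q")
      case True
      have "continuous_on {p..q} (deriv f)"
        by (intro smooth_continuous smooth_deriv f)
      then have "bounded (deriv f ` {p..q})"
        by (intro compact_imp_bounded compact_continuous_image) auto
      then obtain B where B: "\<And>x. x \<in> {p..q} \<Longrightarrow> \<bar>deriv f x\<bar> \<le> B"
        unfolding bounded_iff by force
      have "deriv f x = 0" if "x \<notin> {p..q}" for x
        by (rule deriv_vanishes_outside[OF _ that]) (rule supp)
      then have B': "\<bar>deriv f x\<bar> \<le> \<bar>B\<bar>" for x
        using B[of x] by (cases "x \<in> {p..q}") fastforce+
      have meas: "deriv f \<in> borel_measurable borel"
        by (intro borel_measurable_continuous_onI smooth_continuous smooth_deriv f)
      have "(LINT y:{p..q}|lborel. deriv f y *\<^sub>R (base_cut Y u y - U y))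
        = (LINT y:{p..q}|lborel. deriv f y *\<^sub>R base_cut Y u y) - (LINT y:{p..q}|lborel. deriv f y *\<^sub>R U y)"
        unfolding scaleR_diff_right
        by (intro set_integral_diff(2) set_integrable_bounded_mult[OF _ meas B'] U_int L2_locally_integrable u)
      also have "(LINT y:{p..q}|lborel. deriv f y *\<^sub>R base_cut Y u y) = - (LINT y:{p..q}|lborel. f y *\<^sub>R base_cut Y v y)"
        by (rule weak_deriv_local_test[OF uv f pq supp])
      also have "(LINT y:{p..q}|lborel. deriv f y *\<^sub>R U y) = - (LINT y:{p..q}|lborel. f y *\<^sub>R base_cut Y v y)"
        using U(2) f vanishes_at_ends[OF smooth_continuous[OF f] supp]
        by (intro antiderivative_by_parts[where c = "U p"] True L2_locally_integrable v) auto
      finally show ?thesis by simp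
    next
      case False
      then have "{p..q} = {}" by auto
      then show ?thesis by (simp only: set_lebesgue_integral_def) simp
    qed
  qed
  then obtain C where C: "AE y in lborel. y \<in> base_interior Y \<longrightarrow> base_cut Y u y - U y = C" by blast
  \<comment> \<open>The point 0 lies in the carrier of the circle but not in its interior.\<close>
  have "AE y in lborel. y \<noteq> (0::real)" by (rule AE_lborel_singleton)
  with C have "AE y in lborel. y \<in> base_carrier Y \<longrightarrow> u y = U y + C"
  proof eventually_elim
    case (elim y)
    then show ?case by (cases Y) (auto simp: base_cut_def algebra_simps)
  qed
  moreover have "U (2 * pi) = U 0" if "Y = Circle"
  proof -
    have "(LINT s:{0..2 * pi}|lborel. base_cut Y v s) = (LINT y|lborel. base_cut Y v y)"
      unfolding set_lebesgue_integral_def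
      by (rule Bochner_Integration.integral_cong) (auto simp: that base_cut_def indicator_def)
    then show ?thesis
      using U(2)[of 0 "2 * pi"] weak_deriv_circle_mean_zero[of u v] uv that by simp
  qed
  moreover have "continuous_on UNIV (\<lambda>y. U y + C)"
    using U(1) by (intro continuous_intros)
  ultimately show ?thesis
    using U(2) by (intro exI[of _ "\<lambda>y. U y + C"]) (auto simp: AE_base_measure)
qed

text \<open>Once v has a continuous representative g on the closure, U is a constant plus the
  integral of g, and the fundamental theorem applies up to the ends of the circle.\<close>

lemma primitive_has_vector_derivative:
  assumes U: "\<And>p q. p \<le> q \<Longrightarrow> U q = U p + (LINT s:{p..q}|lborel. base_cut Y v s)"
    and v: "v \<in> L2 Y" and vg: "AE y in base_measure Y. v y = g y"
    and g: "continuous_on (base_closure Y) g" and x: "x \<in> base_closure Y"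
  shows "(U has_vector_derivative g x) (at x within base_closure Y)"
proof -
  obtain a b where ab: "a \<le> b" "x \<in> {a..b}" "{a..b} \<subseteq> base_closure Y" "at x within base_closure Y = at x within {a..b}"
  proof (cases Y)
    case Line
    have "at x within {x-1..x+1} = at x" by (rule at_within_interior) simp
    then show ?thesis using Line by (intro that[of "x - 1" "x + 1"]) auto
  next
    case Circle
    then show ?thesis using x by (intro that[of 0 "2 * pi"]) auto
  qed
  have cont: "continuous_on {a..b} g" using g ab by (meson continuous_on_subset)
  have U': "U y = U a + integral {a..y} g" if y: "y \<in> {a..b}" for y
  proof -
    have sub: "{a..y} \<subseteq> base_closure Y" using ab y by auto
    \<comment> \<open>The point 2 pi lies in the closure but not in the carrier, so
      \<open>base_cut\<close> is zero there.\<close>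
    have "AE s in lborel. s \<noteq> 2 * pi" by (rule AE_lborel_singleton)
    then have "AE s in lborel. s \<in> {a..y} \<longrightarrow> base_cut Y v s = g s"
      using vg[unfolded AE_base_measure]
    proof eventually_elim
      case (elim s)
      then show ?case using sub by (cases Y) (auto simp: base_cut_def)
    qed
    moreover have gi: "set_integrable lborel {a..y} g"
      unfolding set_integrable_def
      by (rule borel_integrable_compact) (use cont y in \<open>auto intro: continuous_on_subset\<close>)
    ultimately have "(LINT s:{a..y}|lborel. base_cut Y v s) = (LINT s:{a..y}|lborel. g s)"
      using L2_locally_integrable[OF v, of a y]
      unfolding set_lebesgue_integral_def set_integrable_def
      by (intro integral_cong_AE) (auto intro: borel_measurable_integrable simp: indicator_def)
    also have "\<dots> = integral {a..y} g"
      by (rule set_borel_integral_eq_integral(2)[OF gi])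
    finally show ?thesis using U[of a y] y by simp
  qed
  have "((\<lambda>y. U a + integral {a..y} g) has_vector_derivative g x) (at x within {a..b})"
    using has_vector_derivative_add[OF has_vector_derivative_const integral_has_vector_derivative[OF cont ab(2)]]
    by simp
  then have "(U has_vector_derivative g x) (at x within {a..b})"
    by (rule has_vector_derivative_transform[OF ab(2) U', rotated]) simp
  then show ?thesis using ab by simp
qed

section \<open>Eigenfunctions as classical solutions\<close>

definition drift :: "base \<Rightarrow> real \<Rightarrow> real \<Rightarrow> real" where
  "drift Y \<xi> y = \<xi> + deriv (potential Y) y"

lemma drift_simps:
  "drift Line \<xi> y = \<xi> + y\<^sup>2" "drift Circle \<xi> y = \<xi> + cos y"
proof -
  have "((\<lambda>y. y ^ 3 / 3) has_real_derivative y\<^sup>2) (at y)"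
    by (auto intro!: derivative_eq_intros)
  moreover have "potential Line = (\<lambda>y. y ^ 3 / 3)" by auto
  ultimately show "drift Line \<xi> y = \<xi> + y\<^sup>2"
    by (simp add: drift_def DERIV_imp_deriv)
  have "potential Circle = sin" by auto
  then show "drift Circle \<xi> y = \<xi> + cos y"
    by (simp add: drift_def DERIV_imp_deriv[OF DERIV_sin])
qed

lemma continuous_on_drift [continuous_intros]: "continuous_on S (drift Y \<xi>)"
  by (cases Y) (auto simp: drift_simps[abs_def] intro!: continuous_intros)

text \<open>What is kept of the operator domain once functions are classical. The weight
  \<open>1 + y ^ 4\<close> on U controls boundary terms with quadratically growing multipliers; on
  the circle, periodicity cancels them.\<close>

fun boundary_cond :: "base \<Rightarrow> (real \<Rightarrow> complex) \<Rightarrow> (real \<Rightarrow> complex) \<Rightarrow> bool" where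
  "boundary_cond Line U V \<longleftrightarrow>
     integrable lborel (\<lambda>y. (1 + y ^ 4) * (cmod (U y))\<^sup>2) \<and> integrable lborel (\<lambda>y. (cmod (V y))\<^sup>2)"
| "boundary_cond Circle U V \<longleftrightarrow> U (2 * pi) = U 0 \<and> V (2 * pi) = V 0"

definition eigen_pair :: "base \<Rightarrow> real \<Rightarrow> real \<Rightarrow> real \<Rightarrow> (real \<Rightarrow> complex) \<Rightarrow> (real \<Rightarrow> complex) \<Rightarrow> bool" where
  "eigen_pair Y h \<xi> \<mu> U V \<longleftrightarrow> boundary_cond Y U V \<and>
     (\<forall>y\<in>base_closure Y.
        (U has_vector_derivative (V y - drift Y \<xi> y *\<^sub>R U y) /\<^sub>R h) (at y within base_closure Y) \<and>
        (V has_vector_derivative (drift Y \<xi> y *\<^sub>R V y - \<mu> *\<^sub>R U y) /\<^sub>R h) (at y within base_closure Y))"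

lemma P_domain_weak_deriv:
  assumes "u \<in> P_domain Y"
  shows "has_weak_deriv Y u (weak_deriv Y u)"
proof -
  have "\<exists>v. has_weak_deriv Y u v" using assms by (cases Y) auto
  then show ?thesis unfolding weak_deriv_def by (rule someI_ex)
qed

lemma AE_eq_integrable_sq:
  assumes "u \<in> L2 Line" "AE y in lborel. u y = U y" "continuous_on UNIV U"
  shows "integrable lborel (\<lambda>y. (cmod (U y))\<^sup>2)"
proof (rule integrable_cong_AE_imp)
  show "integrable lborel (\<lambda>y. (cmod (u y))\<^sup>2)" using assms(1) by (simp add: L2_def)
  have "U \<in> borel_measurable borel" using assms(3) by (rule borel_measurable_continuous_onI)
  then show "(\<lambda>y. (cmod (U y))\<^sup>2) \<in> borel_measurable lborel" by measurable
  show "AE y in lborel. (cmod (u y))\<^sup>2 = (cmod (U y))\<^sup>2" using assms(2) by eventually_elim simp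
qed

text \<open>The weak derivatives are Hilbert choices, tied down by the two operator equations.
  Solved for the derivative, these express it almost everywhere through continuous functions, so
  continuity of both components precedes differentiability.\<close>

lemma eigenspace_eigen_pair:
  assumes u: "u \<in> PP_eigenspace Y h \<xi> \<mu>" and h: "h > 0"
  shows "\<exists>U V. eigen_pair Y h \<xi> \<mu> U V \<and> (AE y in base_measure Y. u y = U y)"
proof -
  define w where "w = P_op Y h \<xi> u"
  have dom: "u \<in> P_domain Y" "w \<in> P_domain Y"
    and eq: "AE y in base_measure Y. P_adj Y h \<xi> w y = complex_of_real \<mu> * u y"
    using u by (auto simp: PP_eigenspace_def w_def)
  note wd = dom[THEN P_domain_weak_deriv]
  have L2: "weak_deriv Y u \<in> L2 Y" "weak_deriv Y w \<in> L2 Y"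
    using wd by (auto simp: has_weak_deriv_def)
  obtain U where U: "continuous_on UNIV U" "AE y in base_measure Y. u y = U y"
    "\<And>p q. p \<le> q \<Longrightarrow> U q = U p + (LINT s:{p..q}|lborel. base_cut Y (weak_deriv Y u) s)"
    "Y = Circle \<Longrightarrow> U (2 * pi) = U 0"
    using weak_deriv_primitive[OF wd(1)] by blast
  obtain V where V: "continuous_on UNIV V" "AE y in base_measure Y. w y = V y"
    "\<And>p q. p \<le> q \<Longrightarrow> V q = V p + (LINT s:{p..q}|lborel. base_cut Y (weak_deriv Y w) s)"
    "Y = Circle \<Longrightarrow> V (2 * pi) = V 0"
    using weak_deriv_primitive[OF wd(2)] by blast
  note cont = U(1)[THEN continuous_on_subset, OF subset_UNIV] V(1)[THEN continuous_on_subset, OF subset_UNIV]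
  have "AE y in base_measure Y. weak_deriv Y u y = (V y - drift Y \<xi> y *\<^sub>R U y) /\<^sub>R h"
    using U(2) V(2)
  proof eventually_elim
    case (elim y)
    have "V y = complex_of_real h * weak_deriv Y u y + complex_of_real (drift Y \<xi> y) * U y"
      using elim by (simp add: w_def P_op_def drift_def)
    then have "V y - drift Y \<xi> y *\<^sub>R U y = h *\<^sub>R weak_deriv Y u y"
      by (simp add: scaleR_conv_of_real)
    then show ?case using h by simp
  qed
  then have derU: "(U has_vector_derivative (V y - drift Y \<xi> y *\<^sub>R U y) /\<^sub>R h) (at y within base_closure Y)"
    if "y \<in> base_closure Y" for y
    by (intro primitive_has_vector_derivative[OF U(3) L2(1) _ _ that]) (auto intro!: continuous_intros cont)
  have "AE y in base_measure Y. weak_deriv Y w y = (drift Y \<xi> y *\<^sub>R V y - \<mu> *\<^sub>R U y) /\<^sub>R h"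
    using U(2) V(2) eq
  proof eventually_elim
    case (elim y)
    have "- complex_of_real h * weak_deriv Y w y + complex_of_real (drift Y \<xi> y) * V y = complex_of_real \<mu> * U y"
      using elim by (simp add: P_adj_def drift_def)
    then have "drift Y \<xi> y *\<^sub>R V y - \<mu> *\<^sub>R U y = h *\<^sub>R weak_deriv Y w y"
      by (simp add: scaleR_conv_of_real algebra_simps)
    then show ?case using h by simp
  qed
  then have derV: "(V has_vector_derivative (drift Y \<xi> y *\<^sub>R V y - \<mu> *\<^sub>R U y) /\<^sub>R h) (at y within base_closure Y)"
    if "y \<in> base_closure Y" for y
    by (intro primitive_has_vector_derivative[OF V(3) L2(2) _ _ that]) (auto intro!: continuous_intros cont)
  have "boundary_cond Y U V"
  proof (cases Y)
    case Line
    have "integrable lborel (\<lambda>y. (cmod (complex_of_real (sqrt (1 + y ^ 4)) * U y))\<^sup>2)"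
    proof (rule AE_eq_integrable_sq)
      show "(\<lambda>y. complex_of_real (sqrt (1 + y ^ 4)) * u y) \<in> L2 Line" using dom(1) Line by simp
      have "AE y in lborel. u y = U y" using U(2) unfolding Line base_measure.simps .
      then show "AE y in lborel. complex_of_real (sqrt (1 + y ^ 4)) * u y = complex_of_real (sqrt (1 + y ^ 4)) * U y"
        by eventually_elim simp
      show "continuous_on UNIV (\<lambda>y. complex_of_real (sqrt (1 + y ^ 4)) * U y)"
        by (intro continuous_intros cont)
    qed
    moreover have "(cmod (complex_of_real (sqrt (1 + y ^ 4)) * U y))\<^sup>2 = (1 + y ^ 4) * (cmod (U y))\<^sup>2" for y
      by (simp add: norm_mult power_mult_distrib)
    ultimately show ?thesis
      using Line AE_eq_integrable_sq[OF _ V(2)[unfolded Line base_measure.simps] V(1)] dom(2) by simp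
  qed (use U V in simp)
  then show ?thesis
    using derU derV U(2) unfolding eigen_pair_def by blast
qed

text \<open>An integrable function need not tend to zero, so decay on the line means an integrable
  majorant near infinity, which forces smallness at suitable radii. On the circle, equal end values
  cancel the boundary term.\<close>

fun decays :: "base \<Rightarrow> (real \<Rightarrow> real) \<Rightarrow> bool" where
  "decays Line K \<longleftrightarrow> (\<exists>m M. integrable lborel m \<and> (\<forall>y. M \<le> \<bar>y\<bar> \<longrightarrow> \<bar>K y\<bar> \<le> m y))"
| "decays Circle K \<longleftrightarrow> K (2 * pi) = K 0"

lemma integrable_small_somewhere:
  fixes m :: "real \<Rightarrow> real"
  assumes m: "integrable lborel m" and e: "e > 0"
  shows "\<exists>R\<ge>M. m R < e"
proof (rule ccontr)
  assume "\<not> ?thesis"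
  then have ge: "m R \<ge> e" if "R \<ge> M" for R using that by force
  \<comment> \<open>Chosen so that the bound e over an interval of length L exceeds the whole
    integral by e.\<close>
  define L where "L = (LINT y|lborel. \<bar>m y\<bar>) / e + 1"
  have "(LINT y|lborel. \<bar>m y\<bar>) \<ge> 0" by simp
  then have L: "L > 0" using e by (simp add: L_def add_nonneg_pos)
  have "(LINT y|lborel. indicat_real {M..M+L} y * e) \<le> (LINT y|lborel. \<bar>m y\<bar>)"
  proof (rule integral_mono)
    show "integrable lborel (\<lambda>y. indicat_real {M..M+L} y * e)"
      using L by (intro integrable_mult_left integrable_real_indicator) auto
    show "integrable lborel (\<lambda>y. \<bar>m y\<bar>)" using m by simp
    show "indicat_real {M..M+L} y * e \<le> \<bar>m y\<bar>" for y
      using ge[of y] e by (auto simp: indicator_def)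
  qed
  then have "L * e \<le> (LINT y|lborel. \<bar>m y\<bar>)" using L by simp
  moreover have "L * e = (LINT y|lborel. \<bar>m y\<bar>) + e"
    using e by (simp add: L_def distrib_right)
  ultimately show False using e by linarith
qed

lemma deriv_le_imp_increment_le:
  fixes K :: "real \<Rightarrow> real"
  assumes ab: "a \<le> b" "{a..b} \<subseteq> S"
    and der: "\<And>y. y \<in> S \<Longrightarrow> (K has_real_derivative K' y) (at y within S)"
    and le: "\<And>y. y \<in> S \<Longrightarrow> K' y \<le> \<phi> y" and cont: "continuous_on S \<phi>"
  shows "K b - K a \<le> (LINT y:{a..b}|lborel. \<phi> y)"
proof -
  have c: "continuous_on {a..b} \<phi>" using cont ab by (meson continuous_on_subset)
  have "(K' has_integral (K b - K a)) {a..b}"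
  proof (rule fundamental_theorem_of_calculus[OF ab(1)])
    fix x assume "x \<in> {a..b}"
    then show "(K has_vector_derivative K' x) (at x within {a..b})"
      using der[of x] ab(2) DERIV_subset
      unfolding has_real_derivative_iff_has_vector_derivative[symmetric] by blast
  qed
  moreover have "(\<phi> has_integral (integral {a..b} \<phi>)) {a..b}"
    using integrable_continuous_interval[OF c] by (rule integrable_integral)
  ultimately have "K b - K a \<le> integral {a..b} \<phi>"
    by (rule has_integral_le) (use le ab in auto)
  also have "integral {a..b} \<phi> = (LINT y:{a..b}|lborel. \<phi> y)"
    by (rule set_borel_integral_eq_integral(2)[symmetric])
       (use borel_integrable_compact[OF compact_Icc c] in \<open>simp add: set_integrable_def\<close>)
  finally show ?thesis .
qed

text \<open>Integrating \<open>K' y \<le> \<phi> y\<close> leaves only boundary values of K. On the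
  line these are taken along radii tending to infinity at which the majorant is small.\<close>

lemma flux_nonneg:
  fixes K :: "real \<Rightarrow> real"
  assumes der: "\<And>y. y \<in> base_closure Y \<Longrightarrow> (K has_real_derivative K' y) (at y within base_closure Y)"
    and le: "\<And>y. y \<in> base_closure Y \<Longrightarrow> K' y \<le> \<phi> y"
    and cont: "continuous_on (base_closure Y) \<phi>" and int: "integrable (base_measure Y) \<phi>"
    and K: "decays Y K"
  shows "0 \<le> (LINT y|base_measure Y. \<phi> y)"
proof (cases Y)
  case Line
  then obtain m M where m: "integrable lborel m" "\<And>y. M \<le> \<bar>y\<bar> \<Longrightarrow> \<bar>K y\<bar> \<le> m y"
    using K by auto
  \<comment> \<open>Adding the reflection makes one radius R good for both R and -R.\<close>
  have "integrable lborel (\<lambda>y. m y + m (- y))"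
    using m(1) lborel_integrable_real_affine[OF m(1), of "-1" 0] by simp
  then have "\<exists>R\<ge>max (real n) M. m R + m (- R) < 1 / real (Suc n)" for n
    using integrable_small_somewhere[of "\<lambda>y. m y + m (- y)" "1 / real (Suc n)" "max (real n) M"] by simp
  then obtain R where R: "\<And>n. R n \<ge> max (real n) M" "\<And>n. m (R n) + m (- R n) < 1 / real (Suc n)"
    by metis
  have R0: "R n \<ge> 0" "R n \<ge> real n" "R n \<ge> M" for n using R(1)[of n] by auto
  have incr: "- (1 / real (Suc n)) \<le> (LINT y:{- R n..R n}|lborel. \<phi> y)" for n
  proof -
    have "K (R n) - K (- R n) \<le> (LINT y:{- R n..R n}|lborel. \<phi> y)"
      by (rule deriv_le_imp_increment_le[where S = UNIV and K' = K']) (use R0[of n] der le cont Line in auto)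
    then show ?thesis
      using m(2)[of "R n"] m(2)[of "- R n"] R(2)[of n] R0[of n] by fastforce
  qed
  have lim: "(\<lambda>n. LINT y:{- R n..R n}|lborel. \<phi> y) \<longlonglongrightarrow> (LINT y|lborel. \<phi> y)"
    unfolding set_lebesgue_integral_def
  proof (rule integral_dominated_convergence)
    have int': "integrable lborel \<phi>" using int Line by simp
    then show [measurable]: "\<phi> \<in> borel_measurable lborel" by (rule borel_measurable_integrable)
    show "(\<lambda>y. indicat_real {- R n..R n} y *\<^sub>R \<phi> y) \<in> borel_measurable lborel" for n
      by measurable
    show "integrable lborel (\<lambda>y. norm (\<phi> y))" using int' by simp
    show "AE y in lborel. norm (indicat_real {- R n..R n} y *\<^sub>R \<phi> y) \<le> norm (\<phi> y)" for n
      by (intro AE_I2) (simp add: indicator_def)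
    show "AE y in lborel. (\<lambda>n. indicat_real {- R n..R n} y *\<^sub>R \<phi> y) \<longlonglongrightarrow> \<phi> y"
    proof (intro AE_I2 tendsto_eventually)
      fix y
      obtain N where "\<bar>y\<bar> \<le> real N" using real_arch_simple by blast
      then have "y \<in> {- R n..R n}" if "n \<ge> N" for n using R0(2)[of n] that by auto
      then show "eventually (\<lambda>n. indicat_real {- R n..R n} y *\<^sub>R \<phi> y = \<phi> y) sequentially"
        unfolding eventually_sequentially by (intro exI[of _ N]) simp
    qed
  qed
  have "(\<lambda>n. - (1 / real (Suc n))) \<longlonglongrightarrow> - 0"
    by (intro tendsto_minus LIMSEQ_Suc lim_1_over_n)
  then have "- 0 \<le> (LINT y|lborel. \<phi> y)"
    using lim by (rule LIMSEQ_le) (use incr in auto)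
  then show ?thesis using Line by simp
next
  case Circle
  have "K (2 * pi) - K 0 \<le> (LINT y:{0..2 * pi}|lborel. \<phi> y)"
    by (rule deriv_le_imp_increment_le[where S = "{0..2 * pi}" and K' = K']) (use der le cont Circle in auto)
  also have "(LINT y:{0..2 * pi}|lborel. \<phi> y) = (LINT y:{0..<2 * pi}|lborel. \<phi> y)"
  proof -
    have "set_integrable lborel {0..<2 * pi} \<phi>" using int Circle by (simp only: integrable_base_measure) simp
    moreover have "set_integrable lborel {0..2 * pi} \<phi>"
      using cont Circle borel_integrable_compact[of "{0..2 * pi}" \<phi>] by (simp add: set_integrable_def)
    moreover have "AE y in lborel. y \<noteq> 2 * pi" by (rule AE_lborel_singleton)
    ultimately show ?thesis
      unfolding set_lebesgue_integral_def set_integrable_def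
      by (intro integral_cong_AE borel_measurable_integrable; auto simp: indicator_def elim: eventually_mono)
  qed
  finally show ?thesis using K Circle by (simp only: integral_base_measure) simp
qed

section \<open>Energy estimates for functions vanishing at a point\<close>

lemma has_real_derivative_inner:
  fixes A B :: "real \<Rightarrow> 'a :: real_inner"
  assumes "(A has_vector_derivative A') (at y within S)" "(B has_vector_derivative B') (at y within S)"
  shows "((\<lambda>y. A y \<bullet> B y) has_real_derivative (A y \<bullet> B' + A' \<bullet> B y)) (at y within S)"
  using bounded_bilinear.has_vector_derivative[OF bounded_bilinear_inner assms]
  by (simp add: has_real_derivative_iff_has_vector_derivative)

text \<open>Used at the pole of the multiplier, where the flux is differentiated through the
  difference quotient of U.\<close>

lemma has_vector_derivative_quotient_tendsto:
  assumes "(f has_vector_derivative D) (at x within S)"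
  shows "((\<lambda>y. (f y - f x) /\<^sub>R (y - x)) \<longlongrightarrow> D) (at x within S)"
proof -
  have "((\<lambda>y. (1 / norm (y - x)) *\<^sub>R (f y - (f x + (y - x) *\<^sub>R D))) \<longlongrightarrow> 0) (at x within S)"
    using assms by (simp add: has_vector_derivative_def has_derivative_within)
  then have "((\<lambda>y. norm ((1 / norm (y - x)) *\<^sub>R (f y - (f x + (y - x) *\<^sub>R D)))) \<longlongrightarrow> 0) (at x within S)"
    by (rule tendsto_norm_zero)
  moreover have "eventually (\<lambda>y. norm ((1 / norm (y - x)) *\<^sub>R (f y - (f x + (y - x) *\<^sub>R D)))
      = norm ((f y - f x) /\<^sub>R (y - x) - D)) (at x within S)"
    unfolding eventually_at_filter
  proof (rule always_eventually, intro allI impI)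
    fix y assume "y \<noteq> x"
    then have "(f y - f x) /\<^sub>R (y - x) - D = (1 / (y - x)) *\<^sub>R (f y - (f x + (y - x) *\<^sub>R D))"
      by (simp add: scaleR_diff_right scaleR_add_right divide_inverse)
    then show "norm ((1 / norm (y - x)) *\<^sub>R (f y - (f x + (y - x) *\<^sub>R D))) = norm ((f y - f x) /\<^sub>R (y - x) - D)"
      by simp
  qed
  ultimately have "((\<lambda>y. norm ((f y - f x) /\<^sub>R (y - x) - D)) \<longlongrightarrow> 0) (at x within S)"
    by (simp add: tendsto_cong)
  then show ?thesis
    by (simp add: tendsto_norm_zero_iff LIM_zero_iff)
qed

lemma abs_inner_le_sum_squares: "\<bar>x \<bullet> y\<bar> \<le> (norm x)\<^sup>2 + (norm y)\<^sup>2"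
proof -
  have "\<bar>x \<bullet> y\<bar> \<le> norm x * norm y" by (rule Cauchy_Schwarz_ineq2)
  also have "\<dots> \<le> (norm x)\<^sup>2 + (norm y)\<^sup>2"
    using sum_squares_bound[of "norm x" "norm y"] mult_nonneg_nonneg[OF norm_ge_zero[of x] norm_ge_zero[of y]]
    by linarith
  finally show ?thesis .
qed

section \<open>Integrability on the base and the energy identity\<close>

lemma integrable_Circle:
  fixes f :: "real \<Rightarrow> real"
  assumes "continuous_on {0..2 * pi} f"
  shows "integrable (base_measure Circle) f"
proof -
  have "set_integrable lborel {0..2 * pi} f"
    using borel_integrable_compact[OF compact_Icc assms] by (simp add: set_integrable_def)
  then have "set_integrable lborel {0..<2 * pi} f"
    by (rule set_integrable_subset) auto
  then show ?thesis by (simp only: integrable_base_measure) simp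
qed

definition square_integrable :: "base \<Rightarrow> (real \<Rightarrow> complex) \<Rightarrow> bool" where
  "square_integrable Y A \<longleftrightarrow>
     continuous_on (base_closure Y) A \<and> integrable (base_measure Y) (\<lambda>y. (cmod (A y))\<^sup>2)"

lemma square_integrable_inner:
  assumes A: "square_integrable Y A" and B: "square_integrable Y B"
  shows "integrable (base_measure Y) (\<lambda>y. A y \<bullet> B y)"
proof (cases Y)
  case Line
  show ?thesis unfolding Line base_measure.simps
  proof (rule Bochner_Integration.integrable_bound)
    show "integrable lborel (\<lambda>y. (cmod (A y))\<^sup>2 + (cmod (B y))\<^sup>2)"
      using A B Line by (intro Bochner_Integration.integrable_add) (simp_all add: square_integrable_def)
    have "A \<in> borel_measurable borel" "B \<in> borel_measurable borel"
      using A B Line by (auto simp: square_integrable_def intro: borel_measurable_continuous_onI)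
    then show "(\<lambda>y. A y \<bullet> B y) \<in> borel_measurable lborel" by measurable
    show "AE y in lborel. norm (A y \<bullet> B y) \<le> norm ((cmod (A y))\<^sup>2 + (cmod (B y))\<^sup>2)"
      using abs_inner_le_sum_squares by (intro AE_I2) simp
  qed
next
  case Circle
  then show ?thesis
    using A B unfolding square_integrable_def
    by (auto intro!: integrable_Circle[unfolded base_measure.simps] continuous_on_inner)
qed

lemma boundary_cond_square_integrable:
  assumes bc: "boundary_cond Y U V" and cont: "continuous_on (base_closure Y) U" "continuous_on (base_closure Y) V"
  shows "square_integrable Y U" "square_integrable Y V"
proof -
  have "integrable (base_measure Y) (\<lambda>y. (cmod (U y))\<^sup>2) \<and> integrable (base_measure Y) (\<lambda>y. (cmod (V y))\<^sup>2)"
  proof (cases Y)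
    case Line
    have "integrable lborel (\<lambda>y. (cmod (U y))\<^sup>2)"
    proof (rule Bochner_Integration.integrable_bound)
      show "integrable lborel (\<lambda>y. (1 + y ^ 4) * (cmod (U y))\<^sup>2)" using bc Line by simp
      have "U \<in> borel_measurable borel" using cont Line by (auto intro: borel_measurable_continuous_onI)
      then show "(\<lambda>y. (cmod (U y))\<^sup>2) \<in> borel_measurable lborel" by measurable
      show "AE y in lborel. norm ((cmod (U y))\<^sup>2) \<le> norm ((1 + y ^ 4) * (cmod (U y))\<^sup>2)"
        by (intro AE_I2) (simp add: abs_mult mult_le_cancel_right1)
    qed
    with bc Line show ?thesis by simp
  next
    case Circle
    with cont show ?thesis by (auto intro!: integrable_Circle[unfolded base_measure.simps] continuous_intros)
  qed
  with cont show "square_integrable Y U" "square_integrable Y V"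
    by (auto simp: square_integrable_def)
qed

lemma eigen_pair_continuous:
  assumes "eigen_pair Y h \<xi> \<mu> U V"
  shows "continuous_on (base_closure Y) U" "continuous_on (base_closure Y) V"
  using assms has_vector_derivative_continuous
  unfolding eigen_pair_def continuous_on_eq_continuous_within by blast+

lemmas eigen_pair_square_integrable =
  boundary_cond_square_integrable[OF eigen_pair_def[THEN iffD1, THEN conjunct1] eigen_pair_continuous]

lemma eigen_pair_scale:
  assumes "eigen_pair Y h \<xi> \<mu> U V"
  shows "eigen_pair Y h \<xi> \<mu> (\<lambda>y. c * U y) (\<lambda>y. c * V y)"
proof -
  have "boundary_cond Y (\<lambda>y. c * U y) (\<lambda>y. c * V y)"
  proof (cases Y)
    case Line
    then have "integrable lborel (\<lambda>y. (cmod c)\<^sup>2 * ((1 + y ^ 4) * (cmod (U y))\<^sup>2))"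
      "integrable lborel (\<lambda>y. (cmod c)\<^sup>2 * (cmod (V y))\<^sup>2)"
      using assms by (auto simp: eigen_pair_def)
    then show ?thesis using Line by (simp add: norm_mult power_mult_distrib mult.left_commute)
  qed (use assms in \<open>simp add: eigen_pair_def\<close>)
  moreover have "((\<lambda>y. c * U y) has_vector_derivative (c * V y - drift Y \<xi> y *\<^sub>R (c * U y)) /\<^sub>R h) (at y within base_closure Y)"
    "((\<lambda>y. c * V y) has_vector_derivative (drift Y \<xi> y *\<^sub>R (c * V y) - \<mu> *\<^sub>R (c * U y)) /\<^sub>R h) (at y within base_closure Y)"
    if "y \<in> base_closure Y" for y
    using assms[unfolded eigen_pair_def, THEN conjunct2, rule_format, OF that]
      has_vector_derivative_mult_right[of U _ _ c] has_vector_derivative_mult_right[of V _ _ c]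
    by (fastforce simp: right_diff_distrib)+
  ultimately show ?thesis unfolding eigen_pair_def by blast
qed

text \<open>The drift terms cancel in the derivative of \<open>h * (A y \<bullet> VB y)\<close>,
  leaving \<open>VA y \<bullet> VB y - \<nu> * (A y \<bullet> B y)\<close>. The product is the real
  inner product of the complex plane, and its symmetry later yields orthogonality.\<close>

lemma eigen_pair_energy:
  assumes A: "eigen_pair Y h \<xi> \<mu> A VA" and B: "eigen_pair Y h \<xi> \<nu> B VB" and h: "h > 0"
  shows "(LINT y|base_measure Y. VA y \<bullet> VB y) = \<nu> * (LINT y|base_measure Y. A y \<bullet> B y)"
proof -
  define K where "K y = h * (A y \<bullet> VB y)" for y
  define \<phi> where "\<phi> y = VA y \<bullet> VB y - \<nu> * (A y \<bullet> B y)" for y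
  note cA = eigen_pair_continuous[OF A] and cB = eigen_pair_continuous[OF B]
  note sA = eigen_pair_square_integrable[OF A A A] and sB = eigen_pair_square_integrable[OF B B B]
  have der: "(K has_real_derivative \<phi> y) (at y within base_closure Y)" if y: "y \<in> base_closure Y" for y
  proof -
    have "((\<lambda>y. A y \<bullet> VB y) has_real_derivative
        (A y \<bullet> ((drift Y \<xi> y *\<^sub>R VB y - \<nu> *\<^sub>R B y) /\<^sub>R h) + ((VA y - drift Y \<xi> y *\<^sub>R A y) /\<^sub>R h) \<bullet> VB y))
        (at y within base_closure Y)"
      using A B y unfolding eigen_pair_def by (intro has_real_derivative_inner) auto
    then have "(K has_real_derivative h *
        (A y \<bullet> ((drift Y \<xi> y *\<^sub>R VB y - \<nu> *\<^sub>R B y) /\<^sub>R h) + ((VA y - drift Y \<xi> y *\<^sub>R A y) /\<^sub>R h) \<bullet> VB y))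
        (at y within base_closure Y)"
      unfolding K_def by (rule DERIV_cmult)
    moreover have "h * (A y \<bullet> ((drift Y \<xi> y *\<^sub>R VB y - \<nu> *\<^sub>R B y) /\<^sub>R h) + ((VA y - drift Y \<xi> y *\<^sub>R A y) /\<^sub>R h) \<bullet> VB y) = \<phi> y"
      using h by (simp add: \<phi>_def inner_diff_left inner_diff_right field_simps)
    ultimately show ?thesis by simp
  qed
  have cont: "continuous_on (base_closure Y) \<phi>"
    unfolding \<phi>_def by (intro continuous_intros cA cB)
  have int: "integrable (base_measure Y) \<phi>"
    unfolding \<phi>_def
    by (intro Bochner_Integration.integrable_diff integrable_mult_right square_integrable_inner sA sB)
  have dec: "decays Y K"
  proof (cases Y)
    case Line
    have "integrable lborel (\<lambda>y. h * ((cmod (A y))\<^sup>2 + (cmod (VB y))\<^sup>2))"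
      using sA sB Line by (intro integrable_mult_right Bochner_Integration.integrable_add)
        (simp_all add: square_integrable_def)
    moreover have "\<bar>K y\<bar> \<le> h * ((cmod (A y))\<^sup>2 + (cmod (VB y))\<^sup>2)" for y
      using h abs_inner_le_sum_squares[of "A y" "VB y"] by (simp add: K_def abs_mult)
    ultimately show ?thesis using Line by auto
  next
    case Circle
    then show ?thesis using A B by (simp add: K_def eigen_pair_def)
  qed
  have "0 \<le> (LINT y|base_measure Y. \<phi> y)"
    by (rule flux_nonneg[OF der _ cont int dec]) auto
  \<comment> \<open>The flux inequality for -K turns the inequality for K into an equality.\<close>
  moreover have "0 \<le> (LINT y|base_measure Y. - \<phi> y)"
  proof (rule flux_nonneg)
    show "((\<lambda>y. - K y) has_real_derivative - \<phi> y) (at y within base_closure Y)" if "y \<in> base_closure Y" for y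
      using der[OF that] by (rule DERIV_minus)
    show "decays Y (\<lambda>y. - K y)" using dec by (cases Y) auto
  qed (use cont int in \<open>auto intro: continuous_intros\<close>)
  ultimately have "(LINT y|base_measure Y. \<phi> y) = 0" by simp
  moreover have "(LINT y|base_measure Y. \<phi> y) = (LINT y|base_measure Y. VA y \<bullet> VB y) - \<nu> * (LINT y|base_measure Y. A y \<bullet> B y)"
    unfolding \<phi>_def
    by (simp add: Bochner_Integration.integral_diff square_integrable_inner sA sB)
  ultimately show ?thesis by simp
qed

text \<open>Quantifies over all pairs with \<open>V = h U' + g U\<close>, not only eigenfunctions,
  because it is applied to a combination of two eigenfunctions whose eigenvalues may differ.\<close>

definition pinned_estimate :: "base \<Rightarrow> real \<Rightarrow> real \<Rightarrow> real \<Rightarrow> real \<Rightarrow> bool" where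
  "pinned_estimate Y h \<xi> p b \<longleftrightarrow> p \<in> base_closure Y \<and>
     (\<forall>U V. U p = 0 \<and> boundary_cond Y U V \<and> continuous_on (base_closure Y) V \<and>
        (\<forall>y\<in>base_closure Y.
          (U has_vector_derivative (V y - drift Y \<xi> y *\<^sub>R U y) /\<^sub>R h) (at y within base_closure Y)) \<longrightarrow>
        b * (LINT y|base_measure Y. (cmod (U y))\<^sup>2) \<le> (LINT y|base_measure Y. (cmod (V y))\<^sup>2))"

text \<open>
  Completing the square: \<open>|V|\<^sup>2 \<ge> 2 k V \<bullet> U - k\<^sup>2 |U|\<^sup>2\<close>, and
  \<open>2 k V \<bullet> U = h (k |U|\<^sup>2)' + (2 k g - h k') |U|\<^sup>2\<close> because \<open>V = h U' + g U\<close>. The multiplier k may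
  have a pole with residue h at p since U vanishes there.
\<close>

lemma pinned_estimate_multiplier:
  assumes h: "h > 0" and p: "p \<in> base_closure Y"
    and k: "\<And>y. y \<in> base_closure Y \<Longrightarrow> y \<noteq> p \<Longrightarrow> (k has_real_derivative k' y) (at y within base_closure Y)"
    and bound: "\<And>y. y \<in> base_closure Y \<Longrightarrow> y \<noteq> p \<Longrightarrow> b \<le> 2 * k y * drift Y \<xi> y - (k y)\<^sup>2 - h * k' y"
    and pole: "((\<lambda>y. (y - p) * k y) \<longlongrightarrow> h) (at p within base_closure Y)"
    and decay: "\<And>U V. U p = 0 \<Longrightarrow> boundary_cond Y U V \<Longrightarrow> decays Y (\<lambda>y. h * (k y * (cmod (U y))\<^sup>2))"
  shows "pinned_estimate Y h \<xi> p b"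
  unfolding pinned_estimate_def
proof (intro conjI p allI impI; elim conjE)
  fix U V
  assume Up: "U p = 0" and bc: "boundary_cond Y U V" and cV: "continuous_on (base_closure Y) V"
    and "\<forall>y\<in>base_closure Y. (U has_vector_derivative (V y - drift Y \<xi> y *\<^sub>R U y) /\<^sub>R h) (at y within base_closure Y)"
  then have dU: "(U has_vector_derivative (V y - drift Y \<xi> y *\<^sub>R U y) /\<^sub>R h) (at y within base_closure Y)"
    if "y \<in> base_closure Y" for y using that by blast
  have cU: "continuous_on (base_closure Y) U"
    using dU has_vector_derivative_continuous unfolding continuous_on_eq_continuous_within by blast
  note sq = boundary_cond_square_integrable[OF bc cU cV]
  define N where "N y = (cmod (U y))\<^sup>2" for y
  define K where "K y = h * (k y * N y)" for y
  define \<phi> where "\<phi> y = (cmod (V y))\<^sup>2 - b * N y" for y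
  \<comment> \<open>Near p, U behaves like \<open>(y - p) * V p / h\<close> and k like
    \<open>h / (y - p)\<close>, so \<open>h * k * |U|^2\<close> behaves like
    \<open>(y - p) * |V p|^2\<close>; this gives the value at p.\<close>
  define K' where "K' y = (if y = p then (cmod (V p))\<^sup>2
      else h * k' y * N y + 2 * k y * (V y \<bullet> U y) - 2 * k y * drift Y \<xi> y * N y)" for y
  have der: "(K has_real_derivative K' y) (at y within base_closure Y)" if y: "y \<in> base_closure Y" for y
  proof (cases "y = p")
    case False
    have "(N has_real_derivative (U y \<bullet> ((V y - drift Y \<xi> y *\<^sub>R U y) /\<^sub>R h) + ((V y - drift Y \<xi> y *\<^sub>R U y) /\<^sub>R h) \<bullet> U y))
        (at y within base_closure Y)"
      using has_real_derivative_inner[OF dU[OF y] dU[OF y]]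
      by (simp add: N_def[abs_def] power2_norm_eq_inner)
    from DERIV_cmult[OF DERIV_mult[OF k[OF y False] this], of h]
    have "(K has_real_derivative h * (k' y * N y +
        (U y \<bullet> ((V y - drift Y \<xi> y *\<^sub>R U y) /\<^sub>R h) + ((V y - drift Y \<xi> y *\<^sub>R U y) /\<^sub>R h) \<bullet> U y) * k y))
        (at y within base_closure Y)"
      unfolding K_def .
    moreover have "h * (k' y * N y +
        (U y \<bullet> ((V y - drift Y \<xi> y *\<^sub>R U y) /\<^sub>R h) + ((V y - drift Y \<xi> y *\<^sub>R U y) /\<^sub>R h) \<bullet> U y) * k y) = K' y"
      using False h
      by (simp add: K'_def N_def power2_norm_eq_inner inner_diff_left inner_diff_right inner_commute[of "U y" "V y"] field_simps)
    ultimately show ?thesis by simp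
  next
    case True
    have Vp: "(U has_vector_derivative V p /\<^sub>R h) (at p within base_closure Y)"
      using dU[OF p] Up by simp
    then have quot: "((\<lambda>y. (U y - U p) /\<^sub>R (y - p)) \<longlongrightarrow> V p /\<^sub>R h) (at p within base_closure Y)"
      by (rule has_vector_derivative_quotient_tendsto)
    have "((\<lambda>y. h * (((y - p) * k y) * (norm ((U y - U p) /\<^sub>R (y - p)))\<^sup>2)) \<longlongrightarrow> h * (h * (norm (V p /\<^sub>R h))\<^sup>2))
        (at p within base_closure Y)"
      by (intro tendsto_mult tendsto_const tendsto_power tendsto_norm pole quot)
    moreover have "h * (h * (norm (V p /\<^sub>R h))\<^sup>2) = K' p"
    proof -
      have "norm (V p /\<^sub>R h) = cmod (V p) / h" using h by (simp add: divide_inverse mult.commute)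
      then show ?thesis using h by (simp add: K'_def power_divide power2_eq_square)
    qed
    moreover have "eventually (\<lambda>y. h * (((y - p) * k y) * (norm ((U y - U p) /\<^sub>R (y - p)))\<^sup>2) = (K y - K p) / (y - p))
        (at p within base_closure Y)"
      unfolding eventually_at_filter
    proof (rule always_eventually, intro allI impI)
      fix y assume "y \<noteq> p"
      define t where "t = y - p"
      have t: "t \<noteq> 0" using \<open>y \<noteq> p\<close> by (simp add: t_def)
      have "(norm ((U y - U p) /\<^sub>R t))\<^sup>2 = N y / t\<^sup>2"
        by (simp add: Up N_def power_mult_distrib divide_inverse power_inverse mult.commute)
      then have "h * ((t * k y) * (norm ((U y - U p) /\<^sub>R t))\<^sup>2) = h * (k y * N y) / t"
        using t by (simp add: power2_eq_square)
      then show "h * (((y - p) * k y) * (norm ((U y - U p) /\<^sub>R (y - p)))\<^sup>2) = (K y - K p) / (y - p)"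
        by (simp add: K_def t_def N_def Up)
    qed
    ultimately have "((\<lambda>y. (K y - K p) / (y - p)) \<longlongrightarrow> K' p) (at p within base_closure Y)"
      by (simp add: tendsto_cong)
    then show ?thesis using True by (simp add: has_field_derivative_iff)
  qed
  have le: "K' y \<le> \<phi> y" if y: "y \<in> base_closure Y" for y
  proof (cases "y = p")
    case False
    have "0 \<le> (norm (V y - k y *\<^sub>R U y))\<^sup>2" by simp
    also have "\<dots> = (cmod (V y))\<^sup>2 - 2 * k y * (V y \<bullet> U y) + (k y)\<^sup>2 * N y"
      unfolding N_def power2_norm_eq_inner
      by (simp add: inner_diff_left inner_diff_right inner_commute[of "U y" "V y"] power2_eq_square algebra_simps)
    finally have "2 * k y * (V y \<bullet> U y) - (k y)\<^sup>2 * N y \<le> (cmod (V y))\<^sup>2" by simp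
    moreover have "b * N y \<le> (2 * k y * drift Y \<xi> y - (k y)\<^sup>2 - h * k' y) * N y"
      using bound[OF y False] by (intro mult_right_mono) (simp_all add: N_def)
    ultimately show ?thesis using False by (simp add: K'_def \<phi>_def algebra_simps)
  qed (simp add: K'_def \<phi>_def N_def Up)
  have "0 \<le> (LINT y|base_measure Y. \<phi> y)"
  proof (rule flux_nonneg[OF der le])
    show "continuous_on (base_closure Y) \<phi>"
      unfolding \<phi>_def N_def by (intro continuous_intros cU cV)
    show "integrable (base_measure Y) \<phi>"
      using sq unfolding \<phi>_def N_def square_integrable_def
      by (intro Bochner_Integration.integrable_diff integrable_mult_right) auto
    show "decays Y K"
      using decay[OF Up bc] by (simp add: K_def[abs_def] N_def)
  qed
  also have "\<dots> = (LINT y|base_measure Y. (cmod (V y))\<^sup>2) - b * (LINT y|base_measure Y. (cmod (U y))\<^sup>2)"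
    using sq unfolding \<phi>_def N_def square_integrable_def
    by (simp add: Bochner_Integration.integral_diff)
  finally show "b * (LINT y|base_measure Y. (cmod (U y))\<^sup>2) \<le> (LINT y|base_measure Y. (cmod (V y))\<^sup>2)" by simp
qed

text \<open>The pole is harmless against the drift, since
  \<open>h / (y - a) * (y^2 - a^2) = h * (y + a)\<close>; the derivative of g / 2 contributes
  \<open>- h * y\<close> and leaves the constant \<open>h * a\<close>.\<close>

lemma pinned_estimate_Line:
  assumes h: "h > 0" and a: "a > 0" and \<xi>: "\<xi> = - a\<^sup>2"
  shows "pinned_estimate Line h \<xi> a (h * a)"
proof (rule pinned_estimate_multiplier[OF h])
  define k where "k y = h / (y - a) + (y\<^sup>2 - a\<^sup>2) / 2" for y
  show "a \<in> base_closure Line" by simp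
  show "(k has_real_derivative (- h / (y - a)\<^sup>2 + y)) (at y within base_closure Line)" if "y \<noteq> a" for y
    unfolding k_def using that by (auto intro!: derivative_eq_intros simp: power2_eq_square)
  show "h * a \<le> 2 * k y * drift Line \<xi> y - (k y)\<^sup>2 - h * (- h / (y - a)\<^sup>2 + y)" if "y \<noteq> a" for y
  proof -
    define r where "r = h / (y - a)"
    have r: "r * (y\<^sup>2 - a\<^sup>2) = h * (y + a)" "h / (y - a)\<^sup>2 * h = r\<^sup>2"
      using that by (simp_all add: r_def power2_eq_square field_simps)
    have "2 * k y * drift Line \<xi> y - (k y)\<^sup>2 - h * (- h / (y - a)\<^sup>2 + y)
      = 2 * (r + (y\<^sup>2 - a\<^sup>2) / 2) * (y\<^sup>2 - a\<^sup>2) - (r + (y\<^sup>2 - a\<^sup>2) / 2)\<^sup>2 + h / (y - a)\<^sup>2 * h - h * y"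
      by (simp add: k_def drift_simps \<xi> r_def algebra_simps)
    also have "\<dots> = r * (y\<^sup>2 - a\<^sup>2) - h * y + 3 / 4 * (y\<^sup>2 - a\<^sup>2)\<^sup>2"
    proof -
      have "2 * (r + g / 2) * g - (r + g / 2)\<^sup>2 + r\<^sup>2 - t = r * g - t + 3 / 4 * g\<^sup>2" for g t
        by (simp add: power2_eq_square field_simps)
      then show ?thesis unfolding r(2) .
    qed
    also have "\<dots> = h * a + 3 / 4 * (y\<^sup>2 - a\<^sup>2)\<^sup>2"
      unfolding r(1) by (simp add: algebra_simps)
    finally show ?thesis by simp
  qed
  have "((\<lambda>y. h + (y - a) * ((y\<^sup>2 - a\<^sup>2) / 2)) \<longlongrightarrow> h + (a - a) * ((a\<^sup>2 - a\<^sup>2) / 2)) (at a within base_closure Line)"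
    by (intro tendsto_intros) simp_all
  moreover have "eventually (\<lambda>y. h + (y - a) * ((y\<^sup>2 - a\<^sup>2) / 2) = (y - a) * k y) (at a within base_closure Line)"
    unfolding eventually_at_filter by (rule always_eventually) (simp add: k_def distrib_left)
  ultimately show "((\<lambda>y. (y - a) * k y) \<longlongrightarrow> h) (at a within base_closure Line)"
    by (simp add: tendsto_cong)
  fix U V assume "boundary_cond Line U V"
  then have "integrable lborel (\<lambda>y. h * (h + 1 + a\<^sup>2) * ((1 + y ^ 4) * (cmod (U y))\<^sup>2))" by simp
  moreover have "\<bar>h * (k y * (cmod (U y))\<^sup>2)\<bar> \<le> h * (h + 1 + a\<^sup>2) * ((1 + y ^ 4) * (cmod (U y))\<^sup>2)"
    if "a + 1 \<le> \<bar>y\<bar>" for y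
  proof -
    \<comment> \<open>Beyond \<open>a + 1\<close> the pole is at distance at least one, so k grows
      at most quadratically and is dominated by the weight \<open>1 + y ^ 4\<close>.\<close>
    have "\<bar>y - a\<bar> \<ge> 1" using that a by linarith
    then have "\<bar>h / (y - a)\<bar> \<le> h" using h by (simp add: divide_le_eq mult_le_cancel_left1)
    moreover have "\<bar>(y\<^sup>2 - a\<^sup>2) / 2\<bar> \<le> y\<^sup>2 + a\<^sup>2" by (simp add: abs_le_iff)
    ultimately have "\<bar>k y\<bar> \<le> h + (y\<^sup>2 + a\<^sup>2)" unfolding k_def by linarith
    also have "\<dots> \<le> (h + 1 + a\<^sup>2) * (1 + y ^ 4)"
    proof -
      have "y\<^sup>2 \<le> 1 + y ^ 4"
      proof -
        have "2 * y\<^sup>2 \<le> y ^ 4 + 1" using sum_squares_bound[of "y\<^sup>2" 1] by simp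
        then show ?thesis using zero_le_power2[of y] by linarith
      qed
      moreover have "(h + a\<^sup>2) * 1 \<le> (h + a\<^sup>2) * (1 + y ^ 4)" using h by (intro mult_left_mono) auto
      ultimately show ?thesis by (simp add: algebra_simps)
    qed
    finally have "\<bar>k y\<bar> * (h * (cmod (U y))\<^sup>2) \<le> (h + 1 + a\<^sup>2) * (1 + y ^ 4) * (h * (cmod (U y))\<^sup>2)"
      using h by (intro mult_right_mono) auto
    then show ?thesis using h by (simp add: abs_mult mult_ac)
  qed
  ultimately show "decays Line (\<lambda>y. h * (k y * (cmod (U y))\<^sup>2))"
    unfolding decays.simps by blast
qed

text \<open>Of the two zeros of \<open>cos y - cos \<alpha>\<close>, the one with positive slope is
  \<open>2 * pi - \<alpha>\<close>. There \<open>h / 2\<close> times the cotangent of the half angle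
  has residue h. A nonzero d means that the centre is not a zero of the drift; \<open>shift\<close>
  says that the quadratic left over is nonnegative.\<close>

lemma pinned_estimate_Circle:
  assumes h: "h > 0" and \<alpha>: "0 < \<alpha>" "\<alpha> < pi" and d: "d = \<xi> + cos \<alpha>"
    and shift: "\<And>y. 0 \<le> 3 / 4 * (cos y - cos \<alpha>)\<^sup>2 + 2 * d * (cos y - cos \<alpha>) + d\<^sup>2"
  shows "pinned_estimate Circle h \<xi> (2 * pi - \<alpha>) (h / 2 * sin \<alpha>)"
proof (rule pinned_estimate_multiplier[OF h])
  define s where "s y = sin ((y + \<alpha>) / 2)" for y
  define c where "c y = cos ((y + \<alpha>) / 2)" for y
  define k where "k y = h / 2 * (c y / s y) + (cos y - cos \<alpha>) / 2 + d" for y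
  define p where "p = 2 * pi - \<alpha>"
  have sc: "(s y)\<^sup>2 + (c y)\<^sup>2 = 1" for y by (simp add: s_def c_def)
  have s_deriv: "(s has_real_derivative c y / 2) (at y within S)" for y S
    unfolding s_def c_def by (auto intro!: derivative_eq_intros)
  have c_deriv: "(c has_real_derivative - s y / 2) (at y within S)" for y S
    unfolding s_def c_def by (auto intro!: derivative_eq_intros)
  have s_nz: "s y \<noteq> 0" if "y \<in> base_closure Circle" "y \<noteq> p" for y
  proof (cases "y < p")
    case True
    then have "s y > 0" unfolding s_def using that \<alpha> by (intro sin_gt_zero) (auto simp: p_def)
    then show ?thesis by simp
  next
    case False
    then have "s y < 0" unfolding s_def using that \<alpha> by (intro sin_lt_zero) (auto simp: p_def)
    then show ?thesis by simp
  qed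
  show "2 * pi - \<alpha> \<in> base_closure Circle" using \<alpha> by simp
  show "(k has_real_derivative (h / 2 * (- 1 / (2 * (s y)\<^sup>2)) - sin y / 2)) (at y within base_closure Circle)"
    if "y \<in> base_closure Circle" "y \<noteq> 2 * pi - \<alpha>" for y
  proof -
    have nz: "s y \<noteq> 0" using s_nz that by (simp add: p_def)
    have "((\<lambda>y. c y / s y) has_real_derivative (- s y / 2 * s y - c y * (c y / 2)) / (s y * s y)) (at y within base_closure Circle)"
      by (rule DERIV_divide[OF c_deriv s_deriv nz])
    moreover have "- s y / 2 * s y - c y * (c y / 2) = - 1 / 2"
      using sc[of y] by (simp add: power2_eq_square)
    ultimately have quot: "((\<lambda>y. c y / s y) has_real_derivative - 1 / (2 * (s y)\<^sup>2)) (at y within base_closure Circle)"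
      by (simp add: power2_eq_square)
    show ?thesis
      unfolding k_def by (rule derivative_eq_intros quot refl | simp)+
  qed
  show "h / 2 * sin \<alpha> \<le> 2 * k y * drift Circle \<xi> y - (k y)\<^sup>2 - h * (h / 2 * (- 1 / (2 * (s y)\<^sup>2)) - sin y / 2)"
    if "y \<in> base_closure Circle" "y \<noteq> 2 * pi - \<alpha>" for y
  proof -
    have nz: "s y \<noteq> 0" using s_nz that by (simp add: p_def)
    define g where "g = cos y - cos \<alpha>"
    define x where "x = h / 2 * (c y / s y)"
    define n where "n = sin ((y - \<alpha>) / 2)"
    have "sin ((\<alpha> - y) / 2) = - n"
      using sin_minus[of "(y - \<alpha>) / 2"] by (simp add: n_def minus_divide_left)
    \<comment> \<open>The sum-to-product formulas expose the factor \<open>s y\<close> in g, which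
      cancels the pole of the cotangent.\<close>
    then have "g = - 2 * s y * n" "sin y - sin \<alpha> = 2 * n * c y"
      by (simp_all add: g_def n_def s_def c_def cos_diff_cos sin_diff_sin)
    then have "g = - 2 * s y * n" "sin \<alpha> - sin y = - 2 * n * c y" by linarith+
    then have "x * g = - h * (n * c y)" "h / 2 * (sin \<alpha> - sin y) = - h * (n * c y)"
      using nz by (simp_all add: x_def)
    then have xg: "x * g = h / 2 * (sin \<alpha> - sin y)" by simp
    have "x\<^sup>2 = h\<^sup>2 / 4 * ((1 - (s y)\<^sup>2) / (s y)\<^sup>2)"
      using sc[of y] by (simp add: x_def power_mult_distrib power_divide eq_diff_eq add.commute)
    \<comment> \<open>The double poles of \<open>- k^2\<close> and \<open>- h k'\<close> cancel by
      Pythagoras up to this constant.\<close>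
    then have xx: "h * (h / 2 * (1 / (2 * (s y)\<^sup>2))) - x\<^sup>2 = h\<^sup>2 / 4"
      using nz by (simp add: field_simps power2_eq_square)
    have "2 * k y * drift Circle \<xi> y - (k y)\<^sup>2 - h * (h / 2 * (- 1 / (2 * (s y)\<^sup>2)) - sin y / 2)
      = 2 * (x + g / 2 + d) * (g + d) - (x + g / 2 + d)\<^sup>2 + h * (h / 2 * (1 / (2 * (s y)\<^sup>2))) + h * sin y / 2"
      by (simp add: k_def drift_simps x_def g_def d algebra_simps)
    also have "\<dots> = (h * (h / 2 * (1 / (2 * (s y)\<^sup>2))) - x\<^sup>2) + x * g + h * sin y / 2 + (3 / 4 * g\<^sup>2 + 2 * d * g + d\<^sup>2)"
      by (simp add: power2_eq_square algebra_simps)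
    also have "\<dots> = h\<^sup>2 / 4 + h / 2 * sin \<alpha> + (3 / 4 * g\<^sup>2 + 2 * d * g + d\<^sup>2)"
      unfolding xx xg by (simp add: field_simps)
    finally show ?thesis using shift[of y] zero_le_power2[of h] unfolding g_def by linarith
  qed
  have sp: "s p = 0" "c p = - 1" by (simp_all add: s_def c_def p_def)
  show "((\<lambda>y. (y - (2 * pi - \<alpha>)) * k y) \<longlongrightarrow> h) (at (2 * pi - \<alpha>) within base_closure Circle)"
  proof -
    have "((\<lambda>y. (s y - s p) / (y - p)) \<longlongrightarrow> c p / 2) (at p within base_closure Circle)"
      using s_deriv[of p "base_closure Circle"] by (simp only: has_field_derivative_iff)
    then have lim_s: "((\<lambda>y. s y / (y - p)) \<longlongrightarrow> - 1 / 2) (at p within base_closure Circle)"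
      by (simp add: sp)
    have lim_c: "(c \<longlongrightarrow> - 1) (at p within base_closure Circle)"
      using DERIV_continuous[OF c_deriv[of p "base_closure Circle"]] by (simp add: continuous_within sp)
    have "((\<lambda>y. h / 2 * (c y / (s y / (y - p))) + (y - p) * ((cos y - cos \<alpha>) / 2 + d))
        \<longlongrightarrow> h / 2 * (- 1 / (- 1 / 2)) + (p - p) * ((cos p - cos \<alpha>) / 2 + d)) (at p within base_closure Circle)"
      by (intro tendsto_add tendsto_mult tendsto_divide tendsto_const lim_s lim_c tendsto_diff tendsto_ident_at tendsto_cos) simp_all
    moreover have "eventually (\<lambda>y. h / 2 * (c y / (s y / (y - p))) + (y - p) * ((cos y - cos \<alpha>) / 2 + d) = (y - p) * k y)
        (at p within base_closure Circle)"
      unfolding eventually_at_filter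
      by (rule always_eventually) (simp add: k_def distrib_left)
    ultimately show ?thesis by (simp add: tendsto_cong p_def[symmetric])
  qed
  fix U V assume "boundary_cond Circle U V"
  moreover have "k (2 * pi) = k 0"
  proof -
    \<comment> \<open>A full turn shifts the half angle by pi: sine and cosine both change sign,
      their quotient does not.\<close>
    have "(2 * pi + \<alpha>) / 2 = \<alpha> / 2 + pi" by simp
    then have "s (2 * pi) = - s 0" "c (2 * pi) = - c 0"
      by (simp_all only: s_def c_def sin_periodic_pi cos_periodic_pi) simp_all
    then show ?thesis by (simp add: k_def)
  qed
  ultimately show "decays Circle (\<lambda>y. h * (k y * (cmod (U y))\<^sup>2))" by simp
qed

section \<open>Extracting eigenfunctions from multiplicities\<close>

lemma PP_multiplicity_family:
  assumes "enat k \<le> PP_multiplicity Y h \<xi> \<mu>" "k > 0"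
  shows "\<exists>u. (\<forall>j<k. u j \<in> PP_eigenspace Y h \<xi> \<mu>) \<and> indep_ae Y k u"
proof -
  define X where "X = {enat n | n. \<exists>u. (\<forall>j<n. u j \<in> PP_eigenspace Y h \<xi> \<mu>) \<and> indep_ae Y n u}"
  \<comment> \<open>The supremum may be infinite; but if every independent family had fewer than k
    members, \<open>k - 1\<close> would bound it.\<close>
  have "\<exists>n. enat n \<in> X \<and> k \<le> n"
  proof (rule ccontr)
    assume "\<not> ?thesis"
    then have "x \<le> enat (k - 1)" if x: "x \<in> X" for x
    proof -
      obtain n where n: "x = enat n" using x by (auto simp: X_def)
      with x \<open>\<not> (\<exists>n. enat n \<in> X \<and> k \<le> n)\<close> have "\<not> k \<le> n" by blast
      then show ?thesis using n by simp
    qed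
    then have "PP_multiplicity Y h \<xi> \<mu> \<le> enat (k - 1)"
      unfolding PP_multiplicity_def X_def[symmetric] by (rule Sup_least)
    with assms show False by (meson enat_ord_simps(1) order_trans not_le diff_less zero_less_one)
  qed
  then obtain n u where n: "k \<le> n" "\<And>j. j < n \<Longrightarrow> u j \<in> PP_eigenspace Y h \<xi> \<mu>" "indep_ae Y n u"
    by (auto simp: X_def)
  have "indep_ae Y k u"
    unfolding indep_ae_def
  proof (intro allI impI)
    fix c :: "nat \<Rightarrow> complex" and j
    assume c: "AE y in base_measure Y. (\<Sum>j<k. c j * u j y) = 0" and j: "j < k"
    \<comment> \<open>Padding coefficients with zeros cuts the longer independent family to length
      k.\<close>
    have "(\<Sum>j<n. (if j < k then c j else 0) * u j y) = (\<Sum>j<k. c j * u j y)" for y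
      using n(1) by (intro sum.mono_neutral_cong_right) auto
    then have "AE y in base_measure Y. (\<Sum>j<n. (if j < k then c j else 0) * u j y) = 0"
      using c by simp
    then have "\<forall>j<n. (if j < k then c j else 0) = 0"
      using n(3)[unfolded indep_ae_def, THEN spec, of "\<lambda>j. if j < k then c j else 0"] by (rule mp[rotated])
    then show "c j = 0" using j n(1) by (metis order_less_le_trans)
  qed
  then show ?thesis using n by (intro exI[of _ u]) auto
qed

text \<open>Either one eigenvalue has multiplicity at least two, or at least two distinct
  eigenvalues occur. Independence is recorded for equal eigenvalues; for distinct ones orthogonality
  takes its place.\<close>

lemma two_independent_eigenfunctions:
  assumes S: "finite S" and two: "enat (Suc 1) \<le> (\<Sum>\<mu>\<in>S. PP_multiplicity Y h \<xi> \<mu>)"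
  obtains \<mu> \<nu> u w where "\<mu> \<in> S" "\<nu> \<in> S" "u \<in> PP_eigenspace Y h \<xi> \<mu>" "w \<in> PP_eigenspace Y h \<xi> \<nu>"
    "\<not> (AE y in base_measure Y. u y = 0)" "\<not> (AE y in base_measure Y. w y = 0)"
    "\<mu> = \<nu> \<longrightarrow> indep_ae Y 2 (\<lambda>j. if j = 0 then u else w)"
proof -
  have nonzero: "\<not> (AE y in base_measure Y. u j y = 0)" if u: "indep_ae Y k u" "j < k" for u k j
  proof
    assume "AE y in base_measure Y. u j y = 0"
    moreover have "(\<Sum>i<k. (if i = j then 1 else 0) * u i y) = u j y" for y
      using u(2) by (simp add: if_distrib[of "\<lambda>t. t * _"] sum.delta cong: if_cong)
    ultimately have "\<forall>i<k. (if i = j then 1 else 0 :: complex) = 0"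
      using u(1)[unfolded indep_ae_def, THEN spec, of "\<lambda>i. if i = j then 1 else 0"] by simp
    then show False using u(2) by auto
  qed
  show ?thesis
  proof (cases "\<exists>\<mu>\<in>S. enat 2 \<le> PP_multiplicity Y h \<xi> \<mu>")
    case True
    then obtain \<mu> where \<mu>: "\<mu> \<in> S" and "enat 2 \<le> PP_multiplicity Y h \<xi> \<mu>" by blast
    then obtain u where "\<forall>j<2. u j \<in> PP_eigenspace Y h \<xi> \<mu>" and indep: "indep_ae Y 2 u"
      using PP_multiplicity_family[of 2 Y h \<xi> \<mu>] by auto
    then have u: "u 0 \<in> PP_eigenspace Y h \<xi> \<mu>" "u 1 \<in> PP_eigenspace Y h \<xi> \<mu>" by auto
    have "indep_ae Y 2 (\<lambda>j. if j = 0 then u 0 else u 1)"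
      using indep unfolding indep_ae_def by (simp add: numeral_2_eq_2 lessThan_Suc)
    then show ?thesis
      using nonzero[OF indep] by (intro that[OF \<mu> \<mu> u]) simp_all
  next
    case False
    then have le1: "PP_multiplicity Y h \<xi> \<mu> \<le> 1" if "\<mu> \<in> S" for \<mu>
    proof -
      have "PP_multiplicity Y h \<xi> \<mu> < enat 2" using False that by (meson not_le)
      then show ?thesis
        by (cases "PP_multiplicity Y h \<xi> \<mu>") (auto simp: one_enat_def)
    qed
    define S' where "S' = {\<mu>\<in>S. PP_multiplicity Y h \<xi> \<mu> \<noteq> 0}"
    have "(\<Sum>\<mu>\<in>S. PP_multiplicity Y h \<xi> \<mu>) = (\<Sum>\<mu>\<in>S'. PP_multiplicity Y h \<xi> \<mu>)"
      using S by (intro sum.mono_neutral_right) (auto simp: S'_def)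
    also have "\<dots> \<le> (\<Sum>\<mu>\<in>S'. 1)"
      using le1 by (intro sum_mono) (auto simp: S'_def)
    also have "\<dots> = enat (card S')" by (simp add: of_nat_eq_enat)
    finally have "\<not> card S' \<le> Suc 0" using two by (metis One_nat_def Suc_n_not_le_n enat_ord_simps(1) order_trans)
    moreover have "finite S'" using S by (simp add: S'_def)
    ultimately obtain \<mu> \<nu> where \<mu>\<nu>: "\<mu> \<in> S'" "\<nu> \<in> S'" "\<mu> \<noteq> \<nu>"
      by (auto simp: card_le_Suc0_iff_eq)
    have "enat 1 \<le> PP_multiplicity Y h \<xi> \<kappa>" if "\<kappa> \<in> S'" for \<kappa>
      using that by (cases "PP_multiplicity Y h \<xi> \<kappa>") (auto simp: S'_def zero_enat_def)
    then have "\<exists>u. (\<forall>j<1. u j \<in> PP_eigenspace Y h \<xi> \<kappa>) \<and> indep_ae Y 1 u" if "\<kappa> \<in> S'" for \<kappa>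
      using PP_multiplicity_family[of 1] that by simp
    then obtain u w where "u 0 \<in> PP_eigenspace Y h \<xi> \<mu>" "indep_ae Y 1 u" "w 0 \<in> PP_eigenspace Y h \<xi> \<nu>" "indep_ae Y 1 w"
      using \<mu>\<nu> by (metis zero_less_one)
    then show ?thesis
      using \<mu>\<nu> nonzero[of 1 u 0] nonzero[of 1 w 0] by (intro that[of \<mu> \<nu> "u 0" "w 0"]) (auto simp: S'_def)
  qed
qed

section \<open>Lower bounds for the second singular value\<close>

lemma square_integrable_zero:
  assumes "square_integrable Y U" "(LINT y|base_measure Y. (cmod (U y))\<^sup>2) = 0"
  shows "AE y in base_measure Y. U y = 0"
  using assms integral_nonneg_eq_0_iff_AE[of "base_measure Y" "\<lambda>y. (cmod (U y))\<^sup>2"]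
  by (simp add: square_integrable_def)

text \<open>On the span of two eigenfunctions with eigenvalues at most \<open>s^2\<close> the energy
  is at most \<open>s^2\<close> times the mass, while a nonzero member of the span vanishes at p and
  has energy at least b times its mass. Hence \<open>b \<le> s^2\<close>.\<close>

lemma singular_value_ge:
  assumes h: "h > 0" and est: "pinned_estimate Y h \<xi> p b" and \<beta>: "0 \<le> \<beta>" "\<beta>\<^sup>2 \<le> b"
  shows "ereal \<beta> \<le> singular_value Y h \<xi> 1"
  unfolding singular_value_def
proof (rule Inf_greatest, safe)
  fix s S
  assume s: "0 \<le> s" and S: "finite S" "S \<subseteq> {..s\<^sup>2}"
    and two: "enat (Suc 1) \<le> (\<Sum>\<mu>\<in>S. PP_multiplicity Y h \<xi> \<mu>)"
  obtain \<mu> \<nu> u w where \<mu>\<nu>: "\<mu> \<in> S" "\<nu> \<in> S"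
    and uw: "u \<in> PP_eigenspace Y h \<xi> \<mu>" "w \<in> PP_eigenspace Y h \<xi> \<nu>"
    and nz: "\<not> (AE y in base_measure Y. u y = 0)" "\<not> (AE y in base_measure Y. w y = 0)"
    and indep: "\<mu> = \<nu> \<longrightarrow> indep_ae Y 2 (\<lambda>j. if j = 0 then u else w)"
    using two_independent_eigenfunctions[OF S(1) two] .
  obtain U V where U: "eigen_pair Y h \<xi> \<mu> U V" "AE y in base_measure Y. u y = U y"
    using eigenspace_eigen_pair[OF uw(1) h] by blast
  obtain W Z where W: "eigen_pair Y h \<xi> \<nu> W Z" "AE y in base_measure Y. w y = W y"
    using eigenspace_eigen_pair[OF uw(2) h] by blast
  \<comment> \<open>A nontrivial element of the kernel of evaluation at p.\<close>
  obtain c d where cd: "c * U p + d * W p = 0" "c \<noteq> 0 \<or> d \<noteq> 0"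
  proof (cases "U p = 0")
    case True
    then show ?thesis by (intro that[of 1 0]) auto
  next
    case False
    then show ?thesis by (intro that[of "- W p" "U p"]) auto
  qed
  define A where "A y = c * U y" for y
  define VA where "VA y = c * V y" for y
  define B where "B y = d * W y" for y
  define VB where "VB y = d * Z y" for y
  have A: "eigen_pair Y h \<xi> \<mu> A VA" and B: "eigen_pair Y h \<xi> \<nu> B VB"
    unfolding A_def VA_def B_def VB_def by (rule eigen_pair_scale[OF U(1)] eigen_pair_scale[OF W(1)])+
  note sA = eigen_pair_square_integrable[OF A A A] and sB = eigen_pair_square_integrable[OF B B B]
  note iA = square_integrable_inner[OF sA(1) sA(1)] and iB = square_integrable_inner[OF sB(1) sB(1)]
    and iAB = square_integrable_inner[OF sA(1) sB(1)]
    and jA = square_integrable_inner[OF sA(2) sA(2)] and jB = square_integrable_inner[OF sB(2) sB(2)]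
    and jAB = square_integrable_inner[OF sA(2) sB(2)]
  define a where "a = (LINT y|base_measure Y. A y \<bullet> A y)"
  define e where "e = (LINT y|base_measure Y. B y \<bullet> B y)"
  define x where "x = (LINT y|base_measure Y. A y \<bullet> B y)"
  \<comment> \<open>The mixed energy can be computed from either factor, so x vanishes unless the
    eigenvalues agree.\<close>
  have cross: "\<mu> * x = \<nu> * x"
    using eigen_pair_energy[OF A B h] eigen_pair_energy[OF B A h]
    by (auto simp: x_def inner_commute)
  have nonneg: "a \<ge> 0" "e \<ge> 0" by (simp_all add: a_def e_def)
  have norm_add: "(cmod (F + G))\<^sup>2 = F \<bullet> F + 2 * (F \<bullet> G) + G \<bullet> G" for F G :: complex
    unfolding power2_norm_eq_inner by (simp add: inner_add_left inner_add_right inner_commute)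
  have mass: "(LINT y|base_measure Y. (cmod (A y + B y))\<^sup>2) = a + 2 * x + e"
    unfolding norm_add a_def e_def x_def
    using iA iB iAB by (simp add: Bochner_Integration.integral_add)
  have energy: "(LINT y|base_measure Y. (cmod (VA y + VB y))\<^sup>2) = \<mu> * a + 2 * (\<nu> * x) + \<nu> * e"
    unfolding norm_add a_def e_def x_def
    using jA jB jAB eigen_pair_energy[OF A A h] eigen_pair_energy[OF A B h] eigen_pair_energy[OF B B h]
    by (simp add: Bochner_Integration.integral_add)
  have cont: "continuous_on (base_closure Y) (\<lambda>y. A y + B y)" "continuous_on (base_closure Y) (\<lambda>y. VA y + VB y)"
    using eigen_pair_continuous[OF A] eigen_pair_continuous[OF B] by (auto intro: continuous_on_add)
  have bc: "boundary_cond Y (\<lambda>y. A y + B y) (\<lambda>y. VA y + VB y)"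
  proof (cases Y)
    case Line
    have sum_le: "(cmod (F + G))\<^sup>2 \<le> 2 * (cmod F)\<^sup>2 + 2 * (cmod G)\<^sup>2" for F G :: complex
    proof -
      have "(cmod (F + G))\<^sup>2 \<le> (cmod F + cmod G)\<^sup>2" by (intro power_mono norm_triangle_ineq) simp
      also have "\<dots> \<le> 2 * (cmod F)\<^sup>2 + 2 * (cmod G)\<^sup>2"
        using sum_squares_bound[of "cmod F" "cmod G"] by (simp add: power2_sum)
      finally show ?thesis .
    qed
    have int_add: "integrable lborel (\<lambda>y. r y * (cmod (F y + G y))\<^sup>2)"
      if F: "integrable lborel (\<lambda>y. r y * (cmod (F y))\<^sup>2)" and G: "integrable lborel (\<lambda>y. r y * (cmod (G y))\<^sup>2)"
        and r: "continuous_on UNIV r" "\<And>y. r y \<ge> 0"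
        and FG: "continuous_on UNIV F" "continuous_on UNIV G" for r :: "real \<Rightarrow> real" and F G
    proof (rule Bochner_Integration.integrable_bound)
      show "integrable lborel (\<lambda>y. 2 * (r y * (cmod (F y))\<^sup>2) + 2 * (r y * (cmod (G y))\<^sup>2))"
        using F G by (intro Bochner_Integration.integrable_add integrable_mult_right)
      have "continuous_on UNIV (\<lambda>y. r y * (cmod (F y + G y))\<^sup>2)"
        by (intro continuous_intros r FG)
      then have "(\<lambda>y. r y * (cmod (F y + G y))\<^sup>2) \<in> borel_measurable borel"
        by (rule borel_measurable_continuous_onI)
      then show "(\<lambda>y. r y * (cmod (F y + G y))\<^sup>2) \<in> borel_measurable lborel" by simp
      show "AE y in lborel. norm (r y * (cmod (F y + G y))\<^sup>2)
          \<le> norm (2 * (r y * (cmod (F y))\<^sup>2) + 2 * (r y * (cmod (G y))\<^sup>2))"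
      proof (intro AE_I2)
        fix y
        have "r y * (cmod (F y + G y))\<^sup>2 \<le> r y * (2 * (cmod (F y))\<^sup>2 + 2 * (cmod (G y))\<^sup>2)"
          by (intro mult_left_mono sum_le r)
        then show "norm (r y * (cmod (F y + G y))\<^sup>2)
          \<le> norm (2 * (r y * (cmod (F y))\<^sup>2) + 2 * (r y * (cmod (G y))\<^sup>2))"
          using r(2)[of y] by (simp add: abs_mult algebra_simps)
      qed
    qed
    have bcA: "boundary_cond Line A VA" and bcB: "boundary_cond Line B VB"
      using A B Line by (simp_all only: eigen_pair_def)
    have contAB: "continuous_on UNIV A" "continuous_on UNIV VA" "continuous_on UNIV B" "continuous_on UNIV VB"
      using eigen_pair_continuous[OF A] eigen_pair_continuous[OF B] Line by simp_all
    have "integrable lborel (\<lambda>y. (1 + y ^ 4) * (cmod (A y + B y))\<^sup>2)"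
      by (rule int_add) (use bcA bcB contAB in \<open>auto intro!: continuous_intros\<close>)
    moreover have "integrable lborel (\<lambda>y. 1 * (cmod (VA y + VB y))\<^sup>2)"
      by (rule int_add) (use bcA bcB contAB in auto)
    ultimately show ?thesis using Line by simp
  next
    case Circle
    then show ?thesis using A B by (simp add: eigen_pair_def)
  qed
  have deriv: "((\<lambda>y. A y + B y) has_vector_derivative ((VA y + VB y) - drift Y \<xi> y *\<^sub>R (A y + B y)) /\<^sub>R h)
      (at y within base_closure Y)" if "y \<in> base_closure Y" for y
  proof -
    have "(A has_vector_derivative (VA y - drift Y \<xi> y *\<^sub>R A y) /\<^sub>R h) (at y within base_closure Y)"
      "(B has_vector_derivative (VB y - drift Y \<xi> y *\<^sub>R B y) /\<^sub>R h) (at y within base_closure Y)"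
      using A B that by (auto simp: eigen_pair_def)
    from has_vector_derivative_add[OF this] show ?thesis
      by (simp add: scaleR_add_right scaleR_diff_right algebra_simps)
  qed
  have "A p + B p = 0" using cd by (simp add: A_def B_def)
  then have "b * (LINT y|base_measure Y. (cmod (A y + B y))\<^sup>2) \<le> (LINT y|base_measure Y. (cmod (VA y + VB y))\<^sup>2)"
    using est[unfolded pinned_estimate_def, THEN conjunct2, THEN spec, of "\<lambda>y. A y + B y", THEN spec, of "\<lambda>y. VA y + VB y"]
      bc cont(2) deriv by simp
  then have "b * (a + 2 * x + e) \<le> \<mu> * a + 2 * (\<nu> * x) + \<nu> * e"
    unfolding mass energy .
  also have "\<dots> \<le> s\<^sup>2 * (a + 2 * x + e)"
  proof -
    have le: "\<mu> \<le> s\<^sup>2" "\<nu> \<le> s\<^sup>2" using \<mu>\<nu> S(2) by auto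
    have m0: "a + 2 * x + e \<ge> 0" unfolding mass[symmetric] by simp
    show ?thesis
    \<comment> \<open>Equal eigenvalues make the energy a multiple of the mass; distinct ones give x
      = 0, and the diagonal terms are bounded separately.\<close>
    proof (cases "\<mu> = \<nu>")
      case True
      then have "\<mu> * a + 2 * (\<nu> * x) + \<nu> * e = \<nu> * (a + 2 * x + e)" by (simp add: algebra_simps)
      then show ?thesis using le m0 by (simp add: mult_right_mono)
    next
      case False
      then have "x = 0" using cross by simp
      then show ?thesis
        using mult_right_mono[OF le(1) nonneg(1)] mult_right_mono[OF le(2) nonneg(2)]
        by (simp add: algebra_simps)
    qed
  qed
  finally have main: "b * (a + 2 * x + e) \<le> s\<^sup>2 * (a + 2 * x + e)" .
  \<comment> \<open>For equal eigenvalues, zero mass contradicts independence. For distinct ones, x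
    = 0 makes both summands vanish, although one of them is a nonzero multiple of a nonzero
    eigenfunction.\<close>
  have "a + 2 * x + e \<noteq> 0"
  proof
    assume zero: "a + 2 * x + e = 0"
    show False
    proof (cases "\<mu> = \<nu>")
      case True
      have "AE y in base_measure Y. A y + B y = 0"
        by (rule square_integrable_zero[OF boundary_cond_square_integrable(1)[OF bc cont]])
           (simp add: mass zero)
      with U(2) W(2) have "AE y in base_measure Y. (\<Sum>j<(2::nat). (if j = 0 then c else d) * (if j = 0 then u else w) y) = 0"
        by eventually_elim (simp add: A_def B_def numeral_2_eq_2 lessThan_Suc add.commute)
      then have "\<forall>j<(2::nat). (if j = 0 then c else d) = 0"
        using indep[THEN mp, OF True, unfolded indep_ae_def, THEN spec, of "\<lambda>j. if j = 0 then c else d"] by simp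
      then have "c = 0" "d = 0" by (auto dest: spec[of _ 0] spec[of _ 1])
      then show False using cd by simp
    next
      case False
      then have "x = 0" using cross by simp
      then have "a = 0" "e = 0" using zero nonneg by auto
      then have A0: "AE y in base_measure Y. A y = 0" and B0: "AE y in base_measure Y. B y = 0"
        using square_integrable_zero[OF sA(1)] square_integrable_zero[OF sB(1)]
        by (simp_all add: a_def e_def power2_norm_eq_inner)
      have "AE y in base_measure Y. c * u y = 0" using U(2) A0 by eventually_elim (simp add: A_def)
      moreover have "AE y in base_measure Y. d * w y = 0" using W(2) B0 by eventually_elim (simp add: B_def)
      ultimately show False using cd(2) nz by auto
    qed
  qed
  moreover have "a + 2 * x + e \<ge> 0" unfolding mass[symmetric] by simp
  ultimately have "a + 2 * x + e > 0" by linarith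
  then have "b \<le> s\<^sup>2" using main by (rule mult_right_le_imp_le[rotated])
  with \<beta>(2) have "\<beta>\<^sup>2 \<le> s\<^sup>2" by (rule order_trans)
  then have "\<beta> \<le> s" using s by (rule power2_le_imp_le)
  then show "ereal \<beta> \<le> ereal s" by simp
qed

section \<open>Explicit lower bounds on the line and the circle\<close>

lemma singular_value_Line_ge:
  assumes h: "h > 0" and \<xi>: "\<xi> < 0"
  shows "ereal (h powr (1/2) * \<bar>\<xi>\<bar> powr (1/4)) \<le> singular_value Line h \<xi> 1"
proof (rule singular_value_ge[OF h pinned_estimate_Line[OF h]])
  \<comment> \<open>Here a is \<open>sqrt \<bar>\<xi>\<bar>\<close>, and the quarter power of
    |\<xi>| arises from the square root of the bound \<open>h * a\<close>.\<close>
  show "sqrt \<bar>\<xi>\<bar> > 0" "\<xi> = - (sqrt \<bar>\<xi>\<bar>)\<^sup>2" using \<xi> by simp_all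
  have "(h powr (1/2) * \<bar>\<xi>\<bar> powr (1/4))\<^sup>2 = (h powr (1/2))\<^sup>2 * (\<bar>\<xi>\<bar> powr (1/4))\<^sup>2"
    by (rule power_mult_distrib)
  also have "\<dots> = h * sqrt \<bar>\<xi>\<bar>"
    using h by (simp add: powr_half_sqrt[symmetric] power2_eq_square powr_add[symmetric])
  finally show "(h powr (1/2) * \<bar>\<xi>\<bar> powr (1/4))\<^sup>2 \<le> h * sqrt \<bar>\<xi>\<bar>" by simp
qed simp

text \<open>
  For \<open>|\<xi>| < 1\<close> the multiplier is centred at the well of \<open>\<xi> + cos y\<close>. For \<open>|\<xi>| = 1 + \<delta>\<close> there is
  no well, and it is centred at the well of the parameter of modulus \<open>1 - min \<delta> 1\<close> and the sign
  of \<open>\<xi>\<close>.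
\<close>

lemma singular_value_Circle_ge:
  assumes h: "h > 0"
  shows "ereal (sqrt (h / 2 * sqrt (min \<bar>1 - \<bar>\<xi>\<bar>\<bar> 1))) \<le> singular_value Circle h \<xi> 1"
proof (cases "\<bar>\<xi>\<bar> = 1")
  case True
  \<comment> \<open>At the degenerate values of \<xi> the claimed bound is zero.\<close>
  have "ereal 0 \<le> singular_value Circle h \<xi> 1"
    unfolding singular_value_def by (rule Inf_greatest) auto
  with True show ?thesis by simp
next
  case False
  define \<delta> where "\<delta> = \<bar>1 - \<bar>\<xi>\<bar>\<bar>"
  define \<epsilon> where "\<epsilon> = min \<delta> 1"
  have \<epsilon>: "0 < \<epsilon>" "\<epsilon> \<le> 1" "\<epsilon> \<le> \<delta>" using False by (auto simp: \<epsilon>_def \<delta>_def)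
  \<comment> \<open>z is the cosine at the centre of the multiplier. The cap of \<epsilon> at 1
    keeps \<open>1 - \<epsilon>\<close> nonnegative, so z never has the sign of \<xi>.\<close>
  define z where "z = (if \<bar>\<xi>\<bar> < 1 then - \<xi> else if \<xi> > 0 then \<epsilon> - 1 else 1 - \<epsilon>)"
  have z: "\<bar>z\<bar> \<le> 1 - \<epsilon>"
    using \<epsilon> False by (auto simp: z_def \<epsilon>_def \<delta>_def)
  have z1: "\<bar>z\<bar> < 1" using z \<epsilon> by linarith
  define \<alpha> where "\<alpha> = arccos z"
  have \<alpha>: "0 < \<alpha>" "\<alpha> < pi" "cos \<alpha> = z"
    using z1 by (auto simp: \<alpha>_def arccos_lt_bounded)
  have "pinned_estimate Circle h \<xi> (2 * pi - \<alpha>) (h / 2 * sin \<alpha>)"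
  proof (rule pinned_estimate_Circle[OF h \<alpha>(1,2) refl])
    fix y
    define g where "g = cos y - cos \<alpha>"
    define t where "t = \<xi> + cos \<alpha>"
    have "0 \<le> 3 / 4 * g\<^sup>2 + 2 * t * g + t\<^sup>2"
    proof (cases "\<bar>\<xi>\<bar> < 1")
      case True
      then show ?thesis by (simp add: t_def \<alpha> z_def)
    next
      case out: False
      \<comment> \<open>\<sigma> is the sign of \<xi>, and treats \<xi> \<le> -1 and \<xi> \<ge> 1
        together.\<close>
      define \<sigma> :: real where "\<sigma> = (if \<xi> > 0 then 1 else - 1)"
      have t: "\<sigma> * t = \<delta> + \<epsilon>" using out False
        by (auto simp: \<sigma>_def t_def \<alpha> z_def \<delta>_def)
      have g: "\<sigma> * g \<ge> - \<epsilon>"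
      proof (cases "\<xi> > 0")
        case True
        then have "\<sigma> * g = cos y + 1 - \<epsilon>" using out by (simp add: \<sigma>_def g_def \<alpha> z_def)
        then show ?thesis using cos_ge_minus_one[of y] by linarith
      next
        case False
        then have "\<sigma> * g = 1 - cos y - \<epsilon>" using out by (simp add: \<sigma>_def g_def \<alpha> z_def)
        then show ?thesis using cos_le_one[of y] by linarith
      qed
      define v where "v = \<sigma> * g + \<epsilon>"
      \<comment> \<open>Expansion about the least possible value -\<epsilon> of
        \<open>\<sigma> * g\<close>: v is nonnegative, and \<open>\<epsilon> \<le> \<delta>\<close>
        makes the constant term nonnegative.\<close>
      have "3 / 4 * (\<sigma> * g)\<^sup>2 + 2 * (\<sigma> * t) * (\<sigma> * g) + (\<sigma> * t)\<^sup>2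
          = (\<delta>\<^sup>2 - \<epsilon>\<^sup>2 / 4) + v * (2 * \<delta> + \<epsilon> / 2) + 3 / 4 * v\<^sup>2"
        unfolding t v_def by (simp add: power2_eq_square field_simps)
      moreover have "\<epsilon>\<^sup>2 \<le> \<delta>\<^sup>2" using \<epsilon> by (intro power_mono) auto
      moreover have "v * (2 * \<delta> + \<epsilon> / 2) \<ge> 0" using g \<epsilon> by (intro mult_nonneg_nonneg) (auto simp: v_def)
      ultimately have "0 \<le> 3 / 4 * (\<sigma> * g)\<^sup>2 + 2 * (\<sigma> * t) * (\<sigma> * g) + (\<sigma> * t)\<^sup>2"
        using zero_le_power2[of v] zero_le_power2[of \<epsilon>] by linarith
      also have "\<dots> = 3 / 4 * g\<^sup>2 + 2 * t * g + t\<^sup>2"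
        by (simp add: \<sigma>_def)
      finally show ?thesis .
    qed
    then show "0 \<le> 3 / 4 * (cos y - cos \<alpha>)\<^sup>2 + 2 * (\<xi> + cos \<alpha>) * (cos y - cos \<alpha>) + (\<xi> + cos \<alpha>)\<^sup>2"
      by (simp add: g_def t_def)
  qed
  then show ?thesis
  proof (rule singular_value_ge[OF h])
    \<comment> \<open>From \<open>z^2 \<le> |z| \<le> 1 - \<epsilon>\<close>, the distance to the
      degenerate values bounds the squared sine from below.\<close>
    have "\<epsilon> \<le> 1 - z\<^sup>2"
    proof -
      have "z\<^sup>2 \<le> \<bar>z\<bar> * 1" unfolding power2_eq_square abs_mult_self_eq[of z, symmetric]
        using z1 by (intro mult_left_mono) auto
      then show ?thesis using z by linarith
    qed
    then have "sqrt \<epsilon> \<le> sqrt (1 - z\<^sup>2)" by simp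
    also have "\<dots> = sin \<alpha>" using z1 by (simp add: \<alpha>_def sin_arccos abs_le_iff)
    finally have "h / 2 * sqrt \<epsilon> \<le> h / 2 * sin \<alpha>" using h by (intro mult_left_mono) auto
    then show "(sqrt (h / 2 * sqrt (min \<bar>1 - \<bar>\<xi>\<bar>\<bar> 1)))\<^sup>2 \<le> h / 2 * sin \<alpha>"
      using h \<epsilon> by (simp add: \<epsilon>_def \<delta>_def)
    show "0 \<le> sqrt (h / 2 * sqrt (min \<bar>1 - \<bar>\<xi>\<bar>\<bar> 1))" using h by simp
  qed
qed

text \<open>The cap at 1 is traded for the factor 1 / D, since
  \<open>\<delta> / D \<le> min \<delta> 1\<close>. Two nested roots turn D into its quarter power,
  and sqrt 2 comes from h / 2.\<close>

corollary singular_value_Circle_ge_powr: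
  assumes h: "h > 0" and D: "D \<ge> 1" "\<bar>1 - \<bar>\<xi>\<bar>\<bar> \<le> D"
  shows "ereal (h powr (1/2) * \<bar>1 - \<bar>\<xi>\<bar>\<bar> powr (1/4) / (sqrt 2 * D powr (1/4))) \<le> singular_value Circle h \<xi> 1"
proof -
  define \<delta> where "\<delta> = \<bar>1 - \<bar>\<xi>\<bar>\<bar>"
  have sq: "(t powr (1/4))\<^sup>2 = sqrt t" if "t \<ge> 0" for t :: real
    using that by (simp add: power2_eq_square powr_add[symmetric] powr_half_sqrt)
  have "\<delta> / D \<le> min \<delta> 1"
    using D by (simp add: \<delta>_def divide_le_eq mult_le_cancel_left1)
  then have "h / 2 * sqrt (\<delta> / D) \<le> h / 2 * sqrt (min \<delta> 1)"
    using h by (intro mult_left_mono) auto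
  moreover have "(h powr (1/2) * \<delta> powr (1/4) / (sqrt 2 * D powr (1/4)))\<^sup>2 = h / 2 * sqrt (\<delta> / D)"
    using h D by (simp add: power_divide power_mult_distrib sq powr_half_sqrt real_sqrt_divide \<delta>_def)
  ultimately have "h powr (1/2) * \<delta> powr (1/4) / (sqrt 2 * D powr (1/4)) \<le> sqrt (h / 2 * sqrt (min \<delta> 1))"
    by (intro real_le_rsqrt) simp
  then have "ereal (h powr (1/2) * \<delta> powr (1/4) / (sqrt 2 * D powr (1/4))) \<le> ereal (sqrt (h / 2 * sqrt (min \<delta> 1)))"
    by simp
  also have "\<dots> \<le> singular_value Circle h \<xi> 1"
    unfolding \<delta>_def by (rule singular_value_Circle_ge[OF h])
  finally show ?thesis unfolding \<delta>_def .
qed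

theorem theorem2p4:
  shows
    "(\<forall>K. compact K \<and> K \<subseteq> {..<0} \<longrightarrow>
        (\<exists>C>0. \<exists>h0>0. \<forall>h\<in>{0<..h0}. \<forall>\<xi>\<in>K.
           ereal (h powr (1/2) / C) \<le> singular_value Line h \<xi> 1))
     \<and>
     (\<forall>K. compact K \<and> K \<subseteq> {-1<..<1} \<longrightarrow>
        (\<exists>C>0. \<exists>h0>0. \<forall>h\<in>{0<..h0}. \<forall>\<xi>\<in>K.
           ereal (h powr (1/2) / C) \<le> singular_value Circle h \<xi> 1))
     \<and>
     (\<forall>C0>0. \<exists>C>0. \<exists>h0>0. \<forall>h\<in>{0<..h0}. \<forall>\<xi>.
        (C0 * h powr (2/3) \<le> - \<xi> \<and> - \<xi> \<le> 1 / C0) \<or> - \<xi> \<ge> C0 \<longrightarrow>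
           ereal (h powr (1/2) * \<bar>\<xi>\<bar> powr (1/4) / C) \<le> singular_value Line h \<xi> 1)
     \<and>
     (\<forall>C0>0. \<exists>C>0. \<exists>h0>0. \<forall>h\<in>{0<..h0}. \<forall>\<xi>.
        (C0 * h powr (2/3) \<le> 1 + \<xi> \<and> 1 + \<xi> \<le> 1 / C0) \<or>
        (C0 * h powr (2/3) \<le> 1 - \<xi> \<and> 1 - \<xi> \<le> 1 / C0) \<longrightarrow>
           ereal (h powr (1/2) * \<bar>1 - \<bar>\<xi>\<bar>\<bar> powr (1/4) / C) \<le> singular_value Circle h \<xi> 1)"
proof (intro conjI allI impI)
  fix K :: "real set" assume K: "compact K \<and> K \<subseteq> {..<0}"
  \<comment> \<open>Compactness keeps K at a positive distance \<epsilon> from the degenerate value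
    0; its quarter power is absorbed into the constant.\<close>
  then have "closed K" "0 \<notin> K" using compact_imp_closed by auto
  then obtain \<epsilon> where \<epsilon>: "\<epsilon> > 0" "\<And>\<xi>. \<xi> \<in> K \<Longrightarrow> \<epsilon> \<le> \<bar>\<xi>\<bar>"
    using separate_point_closed[of K 0] by (auto simp: dist_real_def)
  have "ereal (h powr (1/2) / (1 / \<epsilon> powr (1/4))) \<le> singular_value Line h \<xi> 1"
    if "h \<in> {0<..1}" "\<xi> \<in> K" for h \<xi>
  proof -
    have "h powr (1/2) / (1 / \<epsilon> powr (1/4)) \<le> h powr (1/2) * \<bar>\<xi>\<bar> powr (1/4)"
      using \<epsilon> that by (simp add: mult_left_mono powr_mono2)
    then have "ereal (h powr (1/2) / (1 / \<epsilon> powr (1/4))) \<le> ereal (h powr (1/2) * \<bar>\<xi>\<bar> powr (1/4))"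
      by (simp only: ereal_less_eq)
    also have "\<dots> \<le> singular_value Line h \<xi> 1"
      by (rule singular_value_Line_ge) (use that K in auto)
    finally show ?thesis .
  qed
  moreover have "1 / \<epsilon> powr (1/4) > 0" using \<epsilon> by simp
  ultimately show "\<exists>C>0. \<exists>h0>0. \<forall>h\<in>{0<..h0}. \<forall>\<xi>\<in>K. ereal (h powr (1/2) / C) \<le> singular_value Line h \<xi> 1"
    using zero_less_one by blast
next
  fix K :: "real set" assume K: "compact K \<and> K \<subseteq> {-1<..<1}"
  then have "closed K" "1 \<notin> K" "- 1 \<notin> K" using compact_imp_closed by auto
  then obtain \<epsilon>1 \<epsilon>2 where "\<epsilon>1 > 0" "\<epsilon>2 > 0" and sep: "\<And>\<xi>. \<xi> \<in> K \<Longrightarrow> \<epsilon>1 \<le> dist 1 \<xi>" "\<And>\<xi>. \<xi> \<in> K \<Longrightarrow> \<epsilon>2 \<le> dist (- 1) \<xi>"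
    using separate_point_closed[of K 1] separate_point_closed[of K "- 1"] by metis
  define \<epsilon> where "\<epsilon> = min \<epsilon>1 \<epsilon>2"
  have \<epsilon>: "\<epsilon> > 0" using \<open>\<epsilon>1 > 0\<close> \<open>\<epsilon>2 > 0\<close> by (simp add: \<epsilon>_def)
  have "ereal (h powr (1/2) / (sqrt 2 / \<epsilon> powr (1/4))) \<le> singular_value Circle h \<xi> 1"
    if "h \<in> {0<..1}" "\<xi> \<in> K" for h \<xi>
  proof -
    have "- 1 < \<xi>" "\<xi> < 1" using K that by auto
    then have "\<epsilon> \<le> \<bar>1 - \<bar>\<xi>\<bar>\<bar>" "\<bar>1 - \<bar>\<xi>\<bar>\<bar> \<le> 1"
      using sep[OF that(2)] by (auto simp: \<epsilon>_def dist_real_def)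
    then have "h powr (1/2) / (sqrt 2 / \<epsilon> powr (1/4)) \<le> h powr (1/2) * \<bar>1 - \<bar>\<xi>\<bar>\<bar> powr (1/4) / (sqrt 2 * 1 powr (1/4))"
      using \<epsilon> by (simp add: mult_left_mono powr_mono2 divide_right_mono)
    then have "ereal (h powr (1/2) / (sqrt 2 / \<epsilon> powr (1/4)))
        \<le> ereal (h powr (1/2) * \<bar>1 - \<bar>\<xi>\<bar>\<bar> powr (1/4) / (sqrt 2 * 1 powr (1/4)))"
      by (simp only: ereal_less_eq)
    also have "\<dots> \<le> singular_value Circle h \<xi> 1"
      by (rule singular_value_Circle_ge_powr) (use that \<open>\<bar>1 - \<bar>\<xi>\<bar>\<bar> \<le> 1\<close> in auto)
    finally show ?thesis .
  qed
  moreover have "sqrt 2 / \<epsilon> powr (1/4) > 0" using \<epsilon> by simp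
  ultimately show "\<exists>C>0. \<exists>h0>0. \<forall>h\<in>{0<..h0}. \<forall>\<xi>\<in>K. ereal (h powr (1/2) / C) \<le> singular_value Circle h \<xi> 1"
    using zero_less_one by blast
next
  fix C0 :: real assume C0: "C0 > 0"
  have "ereal (h powr (1/2) * \<bar>\<xi>\<bar> powr (1/4) / 1) \<le> singular_value Line h \<xi> 1"
    if "h \<in> {0<..1}" "(C0 * h powr (2/3) \<le> - \<xi> \<and> - \<xi> \<le> 1 / C0) \<or> - \<xi> \<ge> C0" for h \<xi>
  proof -
    have "0 < C0 * h powr (2/3)" using C0 that(1) by simp
    then have "\<xi> < 0" using that(2) C0 by linarith
    then show ?thesis using singular_value_Line_ge[of h \<xi>] that(1) by simp
  qed
  then show "\<exists>C>0. \<exists>h0>0. \<forall>h\<in>{0<..h0}. \<forall>\<xi>.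
        (C0 * h powr (2/3) \<le> - \<xi> \<and> - \<xi> \<le> 1 / C0) \<or> - \<xi> \<ge> C0 \<longrightarrow>
           ereal (h powr (1/2) * \<bar>\<xi>\<bar> powr (1/4) / C) \<le> singular_value Line h \<xi> 1"
    using zero_less_one by blast
next
  fix C0 :: real assume C0: "C0 > 0"
  \<comment> \<open>The upper bounds 1 / C0 let \<xi> leave [-1, 1], but then
    \<open>|1 - |\<xi>||\<close> is at most 1 / C0; inside that interval it is at most 1.\<close>
  define D where "D = max 1 (1 / C0)"
  have "ereal (h powr (1/2) * \<bar>1 - \<bar>\<xi>\<bar>\<bar> powr (1/4) / (sqrt 2 * D powr (1/4))) \<le> singular_value Circle h \<xi> 1"
    if "h \<in> {0<..1}" "(C0 * h powr (2/3) \<le> 1 + \<xi> \<and> 1 + \<xi> \<le> 1 / C0) \<or>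
        (C0 * h powr (2/3) \<le> 1 - \<xi> \<and> 1 - \<xi> \<le> 1 / C0)" for h \<xi>
  proof (rule singular_value_Circle_ge_powr)
    have "0 < C0 * h powr (2/3)" using C0 that(1) by simp
    then show "\<bar>1 - \<bar>\<xi>\<bar>\<bar> \<le> D" using that(2) unfolding D_def by linarith
  qed (use that(1) in \<open>auto simp: D_def\<close>)
  moreover have "sqrt 2 * D powr (1/4) > 0" by (simp add: D_def)
  ultimately show "\<exists>C>0. \<exists>h0>0. \<forall>h\<in>{0<..h0}. \<forall>\<xi>.
        (C0 * h powr (2/3) \<le> 1 + \<xi> \<and> 1 + \<xi> \<le> 1 / C0) \<or>
        (C0 * h powr (2/3) \<le> 1 - \<xi> \<and> 1 - \<xi> \<le> 1 / C0) \<longrightarrow>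
           ereal (h powr (1/2) * \<bar>1 - \<bar>\<xi>\<bar>\<bar> powr (1/4) / C) \<le> singular_value Circle h \<xi> 1"
    using zero_less_one by blast
qed

end
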